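(* Let $n\ge 1$ and let $k$ be a field of characteristic zero or of characteristic prime to $n!$. Then the ideal $\bar{\mathcal{J}}'\subseteq\bar{A}'$ is the $k$-linear span of (i) all $\bar{M}$ for $M\in\mathscr{B}_{a,b}$ with $a>n$ or $b>n$; (ii) all $\sum_{M\in\mathscr{B}_{a,b}}f(M)\bar{M}$ for $f\in\bar{G}_{a,b}$ with $1\le a,b\le n$.
   Context: Let $t_1,\dots,t_n$ be variables of degree $2$ with elementary symmetric polynomials $e_1,\dots,e_n$, and $\Lambda_n=k[e_1,\dots,e_n]=k[t_1,\dots,t_n]^{S_n}$. Let $V=(t_j^{i-1})_{1\le i,j\le n}$, $\Delta=\det V$, $\mathrm{adj}(V)=\Delta V^{-1}$, and $A_l=\mathrm{adj}(V)^T\mathrm{diag}(t_1,\dots,t_n)^{l-1}\mathrm{adj}(V)$, which has entries in $\Lambda_n$. Let $A'=\Lambda_n\otimes_k k[W_1,\dots,W_{n-1}]\otimes_k\bigwedge_k(X_1,\dots,X_n,Y_1,\dots,Y_n)$ with $|W_l|=2l$, $|X_l|=|Y_l|=2l-1$. With $X=(X_1,\dots,X_n)^T$, $Y=(Y_1,\dots,Y_n)^T$ put $R_l'=\Delta^2W_l-X^TA_lY\in A'$ for $1\le l\le n-1$. Let $\mathcal{J}'=\{a\in A'\mid\exists m\ge0:\Delta^{2m}a\in(R_1',\dots,R_{n-1}')\}$. Let $\bar{A}'=A'/(e_1,\dots,e_n)A'$, which is the free graded commutative $k$-algebra on the images $\bar X_l,\bar Y_l$ ($1\le l\le n$), $\bar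 W_l$ ($1\le l\le n-1$), and let $\bar{\mathcal{J}}'$ be the image of $\mathcal{J}'$ in $\bar{A}'$. Weights: give the generators the bidegrees (weights) $\mathsf{w}(e_l)=(0,0)$, $\mathsf{w}(X_l)=(1,0)$, $\mathsf{w}(Y_l)=(0,1)$, $\mathsf{w}(W_l)=(1,1)$, extended multiplicatively; each $R'_l$ is homogeneous of weight $(1,1)$. For $a,b\ge0$ let $\mathscr{B}_{a,b}$ be the (ordered) set of all monomials of weight $(a,b)$ in the variables $X_1,\dots,X_n,Y_1,\dots,Y_n,W_1,\dots,W_{n-1}$; it is a $\Lambda_n$-basis of the weight $(a,b)$ part of $A'$. For $M\in\mathscr{B}_{a,b}$ let $\bar{M}$ be its image in $\bar{A}'$. For $1\le a,b\le n$ let $T_{a,b}$ be the matrix over $\Lambda_n$ of size $|\mathscr{B}_{a,b}|\times(n-1)|\mathscr{B}_{a-1,b-1}|$ whose columns are the coefficient vectors, in the basis $\mathscr{B}_{a,b}$, of the elements $MR_i'$ for $M\in\mathscr{B}_{a-1,b-1}$ and $1\le i\le n-1$. Let $G_{a,b}=\{x\in\Lambda_n^{\mathscr{B}_{a,b}}\mid\exists m\ge0:\Delta^{2m}x\in\mathrm{im}(T_{a,b})\}$ be the $\Delta^2$-saturation of the image $\mathrm{im}(T_{a,b})\subseteq\Lambda_n^{\mathscr{B}_{a,b}}$, let $\varepsilon:\Lambda_n^{\mathscr{B}_{a,b}}\to k^{\mathscr{B}_{a,b}}$ be reduction modulo $(e_1,\dots,e_n)$, and $\bar{G}_{a,b}=\varepsilon(G_{a,b})$.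 *)

theory Defs
  imports
    "HOL-Library.Poly_Mapping"
    "HOL-Library.FuncSet"
    "HOL-Algebra.QuotRing"
    "Jordan_Normal_Form.Determinant"
begin

section \<open>Symmetric polynomials\<close>

text \<open>
  The polynomial ring \<open>k[t\<^sub>1, t\<^sub>2, \<dots>]\<close>: a monomial is a finitely supported exponent vector,
  and \<open>*\<close> on \<open>(nat \<Rightarrow>\<^sub>0 nat) \<Rightarrow>\<^sub>0 'k\<close> is polynomial multiplication.
\<close>

type_synonym 'k tpoly = "(nat \<Rightarrow>\<^sub>0 nat) \<Rightarrow>\<^sub>0 'k"

definition tvar :: "nat \<Rightarrow> 'k::comm_ring_1 tpoly" where
  "tvar i = Poly_Mapping.single (Poly_Mapping.single i 1) 1"

definition tconst :: "'k::comm_ring_1 \<Rightarrow> 'k tpoly" where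
  "tconst c = Poly_Mapping.single 0 c"

text \<open>
  For a permutation \<open>\<pi>\<close>, \<open>Poly_Mapping.map_key \<pi> m\<close> is the exponent vector \<open>i \<mapsto> m (\<pi> i)\<close>.
\<close>

definition sym_polys :: "nat \<Rightarrow> 'k::comm_ring_1 tpoly set" where
  "sym_polys n = {p.
     (\<forall>m \<in> Poly_Mapping.keys p. Poly_Mapping.keys m \<subseteq> {1..n}) \<and>
     (\<forall>\<pi>. \<pi> permutes {1..n} \<longrightarrow>
       (\<forall>m. Poly_Mapping.lookup p (Poly_Mapping.map_key \<pi> m) = Poly_Mapping.lookup p m))}"

definition Lam :: "nat \<Rightarrow> ('k::comm_ring_1 tpoly) ring" where
  "Lam n = \<lparr>carrier = sym_polys n, monoid.mult = (*), one = 1, zero = 0, add = (+)\<rparr>"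

definition esym :: "nat \<Rightarrow> nat \<Rightarrow> 'k::comm_ring_1 tpoly" where
  "esym n l = (\<Sum>S | S \<subseteq> {1..n} \<and> card S = l. \<Prod>i\<in>S. tvar i)"

text \<open>
  Reduction \<open>\<Lambda>\<^sub>n \<rightarrow> \<Lambda>\<^sub>n / (e\<^sub>1, \<dots>, e\<^sub>n) = k\<close>: the unique scalar in the residue class of \<open>p\<close>.
\<close>

definition red :: "nat \<Rightarrow> 'k::comm_ring_1 tpoly \<Rightarrow> 'k" where
  "red n p = (THE c. p - tconst c \<in> Idl\<^bsub>Lam n\<^esub> (esym n ` {1..n}))"

section \<open>The matrices \<open>V\<close> and \<open>A\<^sub>l\<close>\<close>

text \<open>
  Matrix positions count from 0, so position \<open>(i, j)\<close> holds the entry with indices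
  \<open>(i + 1, j + 1)\<close>.
\<close>

definition Vmat :: "nat \<Rightarrow> 'k::comm_ring_1 tpoly mat" where
  "Vmat n = mat n n (\<lambda>(i, j). tvar (j + 1) ^ i)"

definition Delta :: "nat \<Rightarrow> 'k::comm_ring_1 tpoly" where
  "Delta n = det (Vmat n)"

definition Amat :: "nat \<Rightarrow> nat \<Rightarrow> 'k::comm_ring_1 tpoly mat" where
  "Amat n l = transpose_mat (adj_mat (Vmat n)) *
     (mat_diag n (\<lambda>i. tvar (i + 1)) ^\<^sub>m (l - 1)) * adj_mat (Vmat n)"

section \<open>The graded commutative algebra \<open>A'\<close>\<close>

text \<open>
  The triple \<open>(S, T, w)\<close> stands for the monomial
  \<open>X\<^bsub>i\<^sub>1\<^esub> \<cdots> X\<^bsub>i\<^sub>p\<^esub> Y\<^bsub>j\<^sub>1\<^esub> \<cdots> Y\<^bsub>j\<^sub>q\<^esub> W\<^sup>w\<close> where \<open>i\<^sub>1 < \<dots> < i\<^sub>p\<close> are the elements of \<open>S\<close> and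
  \<open>j\<^sub>1 < \<dots> < j\<^sub>q\<close> those of \<open>T\<close>.
\<close>

type_synonym mono = "nat set \<times> nat set \<times> (nat \<Rightarrow>\<^sub>0 nat)"

definition mono_set :: "nat \<Rightarrow> mono set" where
  "mono_set n = {(S, T, w). S \<subseteq> {1..n} \<and> T \<subseteq> {1..n} \<and> Poly_Mapping.keys w \<subseteq> {1..<n}}"

fun mono_mult :: "mono \<Rightarrow> mono \<Rightarrow> mono" where
  "mono_mult (S, T, w) (S', T', w') = (S \<union> S', T \<union> T', w + w')"

definition inversions :: "nat set \<Rightarrow> nat set \<Rightarrow> nat" where
  "inversions S S' = card {(i, j). i \<in> S \<and> j \<in> S' \<and> j < i}"

text \<open>
  All \<open>X\<^sub>i\<close>, \<open>Y\<^sub>j\<close> are odd (they anticommute and have square zero) and all \<open>W\<^sub>l\<close> are even. Bringing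
  \<open>X\<^sub>S Y\<^sub>T \<sqdot> X\<^bsub>S'\<^esub> Y\<^bsub>T'\<^esub>\<close> into standard order moves \<open>X\<^bsub>S'\<^esub>\<close> past \<open>Y\<^sub>T\<close> and then sorts the \<open>X\<close>s and the
  \<open>Y\<close>s.
\<close>

fun mono_sign :: "mono \<Rightarrow> mono \<Rightarrow> 'c::comm_ring_1" where
  "mono_sign (S, T, w) (S', T', w') =
     (if S \<inter> S' = {} \<and> T \<inter> T' = {}
      then (-1) ^ (inversions S S' + card T * card S' + inversions T T') else 0)"

text \<open>Elements of \<open>A'\<close> are given by their coefficients in the monomial basis.\<close>

type_synonym 'k salg = "mono \<Rightarrow>\<^sub>0 'k tpoly"

definition salg_mult :: "'k::comm_ring_1 salg \<Rightarrow> 'k salg \<Rightarrow> 'k salg" (infixl \<open>\<star>\<close> 70) where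
  "f \<star> g = (\<Sum>M \<in> Poly_Mapping.keys f. \<Sum>N \<in> Poly_Mapping.keys g.
     Poly_Mapping.single (mono_mult M N)
       (mono_sign M N * Poly_Mapping.lookup f M * Poly_Mapping.lookup g N))"

definition sconst :: "'k::comm_ring_1 tpoly \<Rightarrow> 'k salg" where
  "sconst p = Poly_Mapping.single ({}, {}, 0) p"

definition smono :: "mono \<Rightarrow> 'k::comm_ring_1 salg" where
  "smono M = Poly_Mapping.single M 1"

definition Xg :: "nat \<Rightarrow> 'k::comm_ring_1 salg" where "Xg i = smono ({i}, {}, 0)"
definition Yg :: "nat \<Rightarrow> 'k::comm_ring_1 salg" where "Yg j = smono ({}, {j}, 0)"
definition Wg :: "nat \<Rightarrow> 'k::comm_ring_1 salg" where
  "Wg l = smono ({}, {}, Poly_Mapping.single l 1)"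

definition salg_carrier :: "nat \<Rightarrow> 'k::comm_ring_1 salg set" where
  "salg_carrier n =
     {f. \<forall>M \<in> Poly_Mapping.keys f. M \<in> mono_set n \<and> Poly_Mapping.lookup f M \<in> sym_polys n}"

definition Aprime :: "nat \<Rightarrow> ('k::comm_ring_1 salg) ring" where
  "Aprime n = \<lparr>carrier = salg_carrier n,
     monoid.mult = (\<star>), one = sconst 1, zero = 0, add = (+)\<rparr>"

definition Rel :: "nat \<Rightarrow> nat \<Rightarrow> 'k::comm_ring_1 salg" where
  "Rel n l = sconst (Delta n ^ 2) \<star> Wg l
     - (\<Sum>i\<in>{1..n}. \<Sum>j\<in>{1..n}. Xg i \<star> sconst (Amat n l $$ (i - 1, j - 1)) \<star> Yg j)"

definition Jprime :: "nat \<Rightarrow> 'k::comm_ring_1 salg set" where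
  "Jprime n = {a \<in> carrier (Aprime n).
     \<exists>m. sconst (Delta n ^ (2 * m)) \<star> a \<in> Idl\<^bsub>Aprime n\<^esub> (Rel n ` {1..<n})}"

section \<open>The quotient by the elementary symmetric polynomials\<close>

definition Eideal :: "nat \<Rightarrow> 'k::comm_ring_1 salg set" where
  "Eideal n = Idl\<^bsub>Aprime n\<^esub> ((\<lambda>l. sconst (esym n l)) ` {1..n})"

definition Abar :: "nat \<Rightarrow> ('k::comm_ring_1 salg set) ring" where
  "Abar n = Aprime n Quot Eideal n"

definition proj :: "nat \<Rightarrow> 'k::comm_ring_1 salg \<Rightarrow> 'k salg set" where
  "proj n a = Eideal n +>\<^bsub>Aprime n\<^esub> a"

definition Jbar :: "nat \<Rightarrow> 'k::comm_ring_1 salg set set" where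
  "Jbar n = proj n ` Jprime n"

definition Mbar :: "nat \<Rightarrow> mono \<Rightarrow> 'k::comm_ring_1 salg set" where
  "Mbar n M = proj n (smono M)"

definition kscale :: "nat \<Rightarrow> 'k::comm_ring_1 \<Rightarrow> 'k salg set \<Rightarrow> 'k salg set" where
  "kscale n c v = proj n (sconst (tconst c)) \<otimes>\<^bsub>Abar n\<^esub> v"

definition kspan :: "nat \<Rightarrow> 'k::comm_ring_1 salg set set \<Rightarrow> 'k salg set set" where
  "kspan n S = {finsum (Abar n) (\<lambda>v. kscale n (c v) v) F | c F. finite F \<and> F \<subseteq> S}"

section \<open>Weights and the saturated images\<close>

definition wdeg :: "(nat \<Rightarrow>\<^sub>0 nat) \<Rightarrow> nat" where
  "wdeg w = (\<Sum>l \<in> Poly_Mapping.keys w. Poly_Mapping.lookup w l)"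

fun weight :: "mono \<Rightarrow> nat \<times> nat" where
  "weight (S, T, w) = (card S + wdeg w, card T + wdeg w)"

definition Bset :: "nat \<Rightarrow> nat \<Rightarrow> nat \<Rightarrow> mono set" where
  "Bset n a b = {M \<in> mono_set n. weight M = (a, b)}"

text \<open>
  Vectors and matrices over a finite index set are functions on it. The rows of \<open>T\<^bsub>a,b\<^esub>\<close> are
  indexed by \<open>M' \<in> \<B>\<^bsub>a,b\<^esub>\<close> and its columns by \<open>(M, i) \<in> \<B>\<^bsub>a-1,b-1\<^esub> \<times> {1, \<dots>, n - 1}\<close>.
\<close>

definition Tmat :: "nat \<Rightarrow> mono \<Rightarrow> mono \<times> nat \<Rightarrow> 'k::comm_ring_1 tpoly" where
  "Tmat n M' = (\<lambda>(M, i). Poly_Mapping.lookup (smono M \<star> Rel n i) M')"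

definition imT :: "nat \<Rightarrow> nat \<Rightarrow> nat \<Rightarrow> (mono \<Rightarrow> 'k::comm_ring_1 tpoly) set" where
  "imT n a b =
     (\<lambda>y. \<lambda>M' \<in> Bset n a b. \<Sum>q \<in> Bset n (a - 1) (b - 1) \<times> {1..<n}. Tmat n M' q * y q) `
       (Bset n (a - 1) (b - 1) \<times> {1..<n} \<rightarrow>\<^sub>E sym_polys n)"

definition Gset :: "nat \<Rightarrow> nat \<Rightarrow> nat \<Rightarrow> (mono \<Rightarrow> 'k::comm_ring_1 tpoly) set" where
  "Gset n a b = {x \<in> Bset n a b \<rightarrow>\<^sub>E sym_polys n.
     \<exists>m. (\<lambda>M \<in> Bset n a b. Delta n ^ (2 * m) * x M) \<in> imT n a b}"

definition Gbar :: "nat \<Rightarrow> nat \<Rightarrow> nat \<Rightarrow> (mono \<Rightarrow> 'k::comm_ring_1) set" where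
  "Gbar n a b = (\<lambda>x. \<lambda>M \<in> Bset n a b. red n (x M)) ` Gset n a b"

section \<open>\<open>\<Lambda>\<^sub>n\<close> and \<open>A'\<close> are rings\<close>

text \<open>
  \<^const>\<open>genideal\<close> and \<^const>\<open>FactRing\<close> have their usual meaning only over a ring.
\<close>

lemma salg_mult_superset:
  assumes "finite A" "finite B" "Poly_Mapping.keys f \<subseteq> A" "Poly_Mapping.keys g \<subseteq> B"
  shows "f \<star> g = (\<Sum>M\<in>A. \<Sum>N\<in>B. Poly_Mapping.single (mono_mult M N)
       (mono_sign M N * Poly_Mapping.lookup f M * Poly_Mapping.lookup g N))"
proof -
  have "f \<star> g = (\<Sum>M\<in>Poly_Mapping.keys f. \<Sum>N\<in>B. Poly_Mapping.single (mono_mult M N)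
       (mono_sign M N * Poly_Mapping.lookup f M * Poly_Mapping.lookup g N))"
    unfolding salg_mult_def
    by (intro sum.cong refl sum.mono_neutral_left) (use assms in \<open>auto simp: in_keys_iff\<close>)
  also have "\<dots> = (\<Sum>M\<in>A. \<Sum>N\<in>B. Poly_Mapping.single (mono_mult M N)
       (mono_sign M N * Poly_Mapping.lookup f M * Poly_Mapping.lookup g N))"
    by (intro sum.mono_neutral_left) (use assms in \<open>auto simp: in_keys_iff\<close>)
  finally show ?thesis .
qed

lemma salg_mult_add_left: "(f + g) \<star> h = f \<star> h + g \<star> h"
proof -
  let ?A = "Poly_Mapping.keys f \<union> Poly_Mapping.keys g \<union> Poly_Mapping.keys (f + g)"
  show ?thesis
    by (subst (1 2 3) salg_mult_superset[where A = ?A and B = "Poly_Mapping.keys h"])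
      (auto simp: lookup_add algebra_simps single_add sum.distrib)
qed

lemma salg_mult_add_right: "h \<star> (f + g) = h \<star> f + h \<star> g"
proof -
  let ?A = "Poly_Mapping.keys f \<union> Poly_Mapping.keys g \<union> Poly_Mapping.keys (f + g)"
  show ?thesis
    by (subst (1 2 3) salg_mult_superset[where B = ?A and A = "Poly_Mapping.keys h"])
      (auto simp: lookup_add algebra_simps single_add sum.distrib)
qed

lemma salg_mult_zero [simp]: "0 \<star> f = 0" "f \<star> 0 = 0"
  by (simp_all add: salg_mult_def)

lemma salg_mult_sum_left: "(\<Sum>i\<in>I. F i) \<star> h = (\<Sum>i\<in>I. F i \<star> h)"
  by (induction I rule: infinite_finite_induct) (auto simp: salg_mult_add_left)

lemma salg_mult_sum_right: "h \<star> (\<Sum>i\<in>I. F i) = (\<Sum>i\<in>I. h \<star> F i)"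
  by (induction I rule: infinite_finite_induct) (auto simp: salg_mult_add_right)

lemma salg_mult_sum_sum: "(\<Sum>i\<in>I. F i) \<star> (\<Sum>j\<in>J. G j) = (\<Sum>i\<in>I. \<Sum>j\<in>J. F i \<star> G j)"
  unfolding salg_mult_sum_left by (simp only: salg_mult_sum_right)

lemma salg_mult_single:
  "Poly_Mapping.single M a \<star> Poly_Mapping.single N b =
     Poly_Mapping.single (mono_mult M N) (mono_sign M N * a * b)"
  by (subst salg_mult_superset[of "{M}" "{N}"]) auto

lemma salg_expand: "(f::'k::comm_ring_1 salg) =
   (\<Sum>M\<in>Poly_Mapping.keys f. Poly_Mapping.single M (Poly_Mapping.lookup f M))"
  by (rule poly_mapping_eqI) (auto simp: lookup_sum lookup_single when_def in_keys_iff sum.delta)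

lemma inversions_union_left:
  assumes "finite S" "finite S'" "finite U" "S \<inter> S' = {}"
  shows "inversions (S \<union> S') U = inversions S U + inversions S' U"
proof -
  have "{(i, j). i \<in> S \<union> S' \<and> j \<in> U \<and> j < i} =
     {(i, j). i \<in> S \<and> j \<in> U \<and> j < i} \<union> {(i, j). i \<in> S' \<and> j \<in> U \<and> j < i}" by auto
  moreover have "finite {(i, j). i \<in> S \<and> j \<in> U \<and> j < i}"
    by (rule finite_subset[of _ "S \<times> U"]) (use assms in auto)
  moreover have "finite {(i, j). i \<in> S' \<and> j \<in> U \<and> j < i}"
    by (rule finite_subset[of _ "S' \<times> U"]) (use assms in auto)
  ultimately show ?thesis unfolding inversions_def
    by (simp add: card_Un_disjoint[symmetric] assms) (subst card_Un_disjoint, use assms in auto)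
qed

lemma inversions_union_right:
  assumes "finite S" "finite S'" "finite U" "S \<inter> S' = {}"
  shows "inversions U (S \<union> S') = inversions U S + inversions U S'"
proof -
  have "{(i, j). i \<in> U \<and> j \<in> S \<union> S' \<and> j < i} =
     {(i, j). i \<in> U \<and> j \<in> S \<and> j < i} \<union> {(i, j). i \<in> U \<and> j \<in> S' \<and> j < i}" by auto
  moreover have "finite {(i, j). i \<in> U \<and> j \<in> S \<and> j < i}"
    by (rule finite_subset[of _ "U \<times> S"]) (use assms in auto)
  moreover have "finite {(i, j). i \<in> U \<and> j \<in> S' \<and> j < i}"
    by (rule finite_subset[of _ "U \<times> S'"]) (use assms in auto)
  ultimately show ?thesis unfolding inversions_def
    by (simp add: card_Un_disjoint[symmetric] assms) (subst card_Un_disjoint, use assms in auto)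
qed

lemma mono_mult_assoc: "mono_mult (mono_mult L M) N = mono_mult L (mono_mult M N)"
  by (cases L; cases M; cases N) (auto simp: add.assoc)

lemma mono_sign_cocycle:
  assumes "L \<in> mono_set n" "M \<in> mono_set n" "N \<in> mono_set n"
  shows "(mono_sign L M * mono_sign (mono_mult L M) N :: 'c::comm_ring_1) =
    mono_sign M N * mono_sign L (mono_mult M N)"
proof -
  obtain S1 T1 w1 S2 T2 w2 S3 T3 w3 where
    eq: "L = (S1, T1, w1)" "M = (S2, T2, w2)" "N = (S3, T3, w3)"
    by (metis prod_cases3)
  have fin: "finite S1" "finite T1" "finite S2" "finite T2" "finite S3" "finite T3"
    using assms finite_subset[of _ "{1..n}"] by (auto simp: eq mono_set_def)
  show ?thesis
  proof (cases "S1 \<inter> S2 = {} \<and> S1 \<inter> S3 = {} \<and> S2 \<inter> S3 = {} \<and> T1 \<inter> T2 = {} \<and> T1 \<inter> T3 = {} \<and> T2 \<inter> T3 = {}")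
    case True
    then have "card (T1 \<union> T2) = card T1 + card T2" "card (S2 \<union> S3) = card S2 + card S3"
      using fin by (auto simp: card_Un_disjoint)
    then have "(inversions S1 S2 + card T1 * card S2 + inversions T1 T2) +
        (inversions (S1 \<union> S2) S3 + card (T1 \<union> T2) * card S3 + inversions (T1 \<union> T2) T3) =
      (inversions S2 S3 + card T2 * card S3 + inversions T2 T3) +
        (inversions S1 (S2 \<union> S3) + card T1 * card (S2 \<union> S3) + inversions T1 (T2 \<union> T3))"
      using True fin by (simp add: inversions_union_left inversions_union_right distrib_left distrib_right)
    then have "((-1) ^ (inversions S1 S2 + card T1 * card S2 + inversions T1 T2) *
        (-1) ^ (inversions (S1 \<union> S2) S3 + card (T1 \<union> T2) * card S3 + inversions (T1 \<union> T2) T3) :: 'c) =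
      (-1) ^ (inversions S2 S3 + card T2 * card S3 + inversions T2 T3) *
        (-1) ^ (inversions S1 (S2 \<union> S3) + card T1 * card (S2 \<union> S3) + inversions T1 (T2 \<union> T3))"
      by (simp only: power_add[symmetric])
    moreover have "(S1 \<union> S2) \<inter> S3 = {}" "S1 \<inter> (S2 \<union> S3) = {}" "(T1 \<union> T2) \<inter> T3 = {}" "T1 \<inter> (T2 \<union> T3) = {}"
      using True by auto
    ultimately show ?thesis
      using True by (simp only: eq mono_sign.simps mono_mult.simps simp_thms if_True)
  next
    case False
    then have "\<not> (S1 \<inter> S2 = {} \<and> T1 \<inter> T2 = {}) \<or> \<not> ((S1 \<union> S2) \<inter> S3 = {} \<and> (T1 \<union> T2) \<inter> T3 = {})"
      "\<not> (S2 \<inter> S3 = {} \<and> T2 \<inter> T3 = {}) \<or> \<not> (S1 \<inter> (S2 \<union> S3) = {} \<and> T1 \<inter> (T2 \<union> T3) = {})"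
      by blast+
    then have "(mono_sign L M * mono_sign (mono_mult L M) N :: 'c) = 0"
      "(mono_sign M N * mono_sign L (mono_mult M N) :: 'c) = 0"
      unfolding eq mono_sign.simps mono_mult.simps
      by (elim disjE; simp only: if_False mult_zero_left mult_zero_right)+
    then show ?thesis by simp
  qed
qed

lemma salg_mult_assoc:
  assumes "Poly_Mapping.keys f \<subseteq> mono_set n" "Poly_Mapping.keys g \<subseteq> mono_set n" "Poly_Mapping.keys h \<subseteq> mono_set n"
  shows "(f \<star> g) \<star> h = f \<star> (g \<star> h)"
proof -
  let ?s = "\<lambda>f M. Poly_Mapping.single M (Poly_Mapping.lookup f M)"
  have "(f \<star> g) \<star> h = ((\<Sum>L\<in>Poly_Mapping.keys f. ?s f L) \<star> (\<Sum>M\<in>Poly_Mapping.keys g. ?s g M)) \<star> (\<Sum>N\<in>Poly_Mapping.keys h. ?s h N)"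
    by (simp only: salg_expand[symmetric])
  also have "\<dots> = (\<Sum>L\<in>Poly_Mapping.keys f. \<Sum>M\<in>Poly_Mapping.keys g. \<Sum>N\<in>Poly_Mapping.keys h. (?s f L \<star> ?s g M) \<star> ?s h N)"
    by (subst salg_mult_sum_sum) (simp only: salg_mult_sum_left, simp only: salg_mult_sum_right)
  also have "\<dots> = (\<Sum>L\<in>Poly_Mapping.keys f. \<Sum>M\<in>Poly_Mapping.keys g. \<Sum>N\<in>Poly_Mapping.keys h. ?s f L \<star> (?s g M \<star> ?s h N))"
  proof (intro sum.cong refl)
    fix L M N assume "L \<in> Poly_Mapping.keys f" "M \<in> Poly_Mapping.keys g" "N \<in> Poly_Mapping.keys h"
    then have "(mono_sign L M * mono_sign (mono_mult L M) N :: 'a tpoly) = mono_sign M N * mono_sign L (mono_mult M N)"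
      using assms by (intro mono_sign_cocycle[of _ n]) auto
    then have cocycle: "(mono_sign L M * mono_sign (mono_mult L M) N :: 'a tpoly) * x =
        mono_sign M N * mono_sign L (mono_mult M N) * x" for x
      by (rule arg_cong)
    have "mono_sign (mono_mult L M) N * (mono_sign L M * a * b) * c =
        mono_sign L (mono_mult M N) * a * (mono_sign M N * b * c)" for a b c :: "'a tpoly"
    proof -
      have "mono_sign (mono_mult L M) N * (mono_sign L M * a * b) * c =
          mono_sign L M * mono_sign (mono_mult L M) N * (a * b * c)"
        by (simp only: mult_ac)
      also note cocycle
      also have "mono_sign M N * mono_sign L (mono_mult M N) * (a * b * c) =
          mono_sign L (mono_mult M N) * a * (mono_sign M N * b * c)"
        by (simp only: mult_ac)
      finally show ?thesis .
    qed
    then show "(?s f L \<star> ?s g M) \<star> ?s h N = ?s f L \<star> (?s g M \<star> ?s h N)"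
      by (simp only: salg_mult_single mono_mult_assoc)
  qed
  also have "\<dots> = (\<Sum>L\<in>Poly_Mapping.keys f. ?s f L) \<star> ((\<Sum>M\<in>Poly_Mapping.keys g. ?s g M) \<star> (\<Sum>N\<in>Poly_Mapping.keys h. ?s h N))"
    by (subst salg_mult_sum_sum) (simp only: salg_mult_sum_left, simp only: salg_mult_sum_right)
  also have "\<dots> = f \<star> (g \<star> h)" by (simp only: salg_expand[symmetric])
  finally show ?thesis .
qed

lemma salg_mult_one: "sconst 1 \<star> f = f" "f \<star> sconst 1 = f"
proof -
  have [simp]: "mono_mult ({}, {}, 0) M = M" "mono_mult M ({}, {}, 0) = M"
    "mono_sign ({}, {}, 0) M = (1::'a tpoly)" "mono_sign M ({}, {}, 0) = (1::'a tpoly)" for M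
    by (cases M; simp add: inversions_def)+
  have "sconst 1 \<star> (\<Sum>M\<in>A. Poly_Mapping.single M (F M)) = (\<Sum>M\<in>A. Poly_Mapping.single M (F M))"
    "(\<Sum>M\<in>A. Poly_Mapping.single M (F M)) \<star> sconst 1 = (\<Sum>M\<in>A. Poly_Mapping.single M (F M))"
    for A and F :: "mono \<Rightarrow> 'a tpoly"
    by (simp_all add: sconst_def salg_mult_sum_left salg_mult_sum_right salg_mult_single)
  from this[where A = "Poly_Mapping.keys f" and F = "Poly_Mapping.lookup f"]
  show "sconst 1 \<star> f = f" "f \<star> sconst 1 = f"
    unfolding salg_expand[of f, symmetric] .
qed

lemma bij_map_key:
  fixes \<pi> :: "nat \<Rightarrow> nat"
  assumes "bij \<pi>"
  shows "bij (Poly_Mapping.map_key \<pi> :: (nat \<Rightarrow>\<^sub>0 nat) \<Rightarrow> _)"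
proof (rule o_bij)
  have i: "inj \<pi>" "inj (inv_into UNIV \<pi>)" using assms by (auto simp: bij_is_inj bij_imp_bij_inv)
  have c: "\<pi> \<circ> inv_into UNIV \<pi> = (\<lambda>x. x)" "inv_into UNIV \<pi> \<circ> \<pi> = (\<lambda>x. x)"
    using assms by (auto simp: fun_eq_iff bij_is_surj surj_f_inv_f bij_is_inj)
  show "Poly_Mapping.map_key (inv_into UNIV \<pi>) \<circ> Poly_Mapping.map_key \<pi> = (id :: (nat \<Rightarrow>\<^sub>0 nat) \<Rightarrow> _)"
    "Poly_Mapping.map_key \<pi> \<circ> Poly_Mapping.map_key (inv_into UNIV \<pi>) = (id :: (nat \<Rightarrow>\<^sub>0 nat) \<Rightarrow> _)"
    by (auto simp: fun_eq_iff map_key_compose i c map_key_id)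
qed

lemma sym_polys_add: "p \<in> sym_polys n \<Longrightarrow> q \<in> sym_polys n \<Longrightarrow> p + q \<in> sym_polys n"
  using keys_add[of p q] by (simp add: sym_polys_def lookup_add) blast

lemma sym_polys_uminus: "p \<in> sym_polys n \<Longrightarrow> - p \<in> sym_polys n"
  by (auto simp: sym_polys_def)

lemma sym_polys_const: "Poly_Mapping.single 0 c \<in> sym_polys n"
proof -
  have "Poly_Mapping.map_key \<pi> m = 0 \<longleftrightarrow> m = 0" if "\<pi> permutes {1..n}" for \<pi> and m :: "nat \<Rightarrow>\<^sub>0 nat"
    using bij_map_key[OF permutes_bij[OF that]] map_key_zero[OF permutes_inj[OF that]]
    by (metis bij_pointE)
  then show ?thesis by (auto simp: sym_polys_def lookup_single when_def)
qed

lemma sym_polys_mult: 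
  assumes "p \<in> sym_polys n" "q \<in> sym_polys n"
  shows "p * q \<in> sym_polys n"
proof -
  have "Poly_Mapping.keys m \<subseteq> {1..n}" if m: "m \<in> Poly_Mapping.keys (p * q)" for m
  proof -
    obtain a b where "m = a + b" "a \<in> Poly_Mapping.keys p" "b \<in> Poly_Mapping.keys q"
      using m keys_mult[of p q] by auto
    then show ?thesis using assms keys_add[of a b] by (simp add: sym_polys_def) blast
  qed
  moreover have "Poly_Mapping.lookup (p * q) (Poly_Mapping.map_key \<pi> m) = Poly_Mapping.lookup (p * q) m"
    if pi: "\<pi> permutes {1..n}" for \<pi> m
  proof -
    let ?k = "Poly_Mapping.map_key \<pi> :: (nat \<Rightarrow>\<^sub>0 nat) \<Rightarrow> _"
    have b: "bij ?k" using bij_map_key[OF permutes_bij[OF pi]] .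
    have add: "?k (a + b) = ?k a + ?k b" for a b by (rule map_key_plus[OF permutes_inj[OF pi]])
    have re: "(Sum_any g :: 'a) = Sum_any (\<lambda>l. g (?k l))" for g
      by (rule Sum_any.reindex_cong[of ?k]) (use b in \<open>auto simp: bij_def comp_def\<close>)
    have inv: "Poly_Mapping.lookup p (?k l) = Poly_Mapping.lookup p l"
       "Poly_Mapping.lookup q (?k l) = Poly_Mapping.lookup q l" for l
      using assms pi by (auto simp: sym_polys_def)
    have "Poly_Mapping.lookup (p * q) (?k m) =
      (\<Sum>l. Poly_Mapping.lookup p l * (\<Sum>r. Poly_Mapping.lookup q r when ?k m = l + r))"
      by (rule lookup_mult)
    also have "\<dots> = (\<Sum>l. Poly_Mapping.lookup p (?k l) * (\<Sum>r. Poly_Mapping.lookup q (?k r) when ?k m = ?k l + ?k r))"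
      by (subst re, subst (2) re) simp
    also have "\<dots> = (\<Sum>l. Poly_Mapping.lookup p l * (\<Sum>r. Poly_Mapping.lookup q r when m = l + r))"
      using b by (simp add: inv add[symmetric] bij_is_inj inj_eq)
    also have "\<dots> = Poly_Mapping.lookup (p * q) m" by (simp add: lookup_mult)
    finally show ?thesis .
  qed
  ultimately show ?thesis by (auto simp: sym_polys_def)
qed

lemma sym_polys_0 [simp]: "0 \<in> sym_polys n" 
  using sym_polys_const[of 0] by simp
lemma sym_polys_1 [simp]: "1 \<in> sym_polys n" 
  using sym_polys_const[of 1] by simp

lemma cring_Lam: "cring (Lam n :: 'k::comm_ring_1 tpoly ring)"
proof (rule cringI)
  show "abelian_group (Lam n :: 'k tpoly ring)"
  proof (rule abelian_groupI)
    show "\<exists>y\<in>carrier (Lam n). y \<oplus>\<^bsub>Lam n\<^esub> x = \<zero>\<^bsub>Lam n\<^esub>" if "x \<in> carrier (Lam n)" for x :: "'k tpoly"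
      using that by (intro bexI[of _ "- x"]) (auto simp: Lam_def sym_polys_uminus)
  qed (auto simp: Lam_def sym_polys_add add_ac)
  show "comm_monoid (Lam n :: 'k tpoly ring)"
    by unfold_locales (auto simp: Lam_def sym_polys_mult mult_ac)
qed (auto simp: Lam_def algebra_simps)

lemma mono_sign_sym: "(mono_sign M N :: 'k::comm_ring_1 tpoly) \<in> sym_polys n"
proof -
  have "(mono_sign M N :: 'k tpoly) \<in> {0, 1, -1}"
    by (cases M; cases N) (auto simp: minus_one_power_iff)
  then show ?thesis using sym_polys_uminus[of 1 n] by auto
qed

lemma salg_carrier_iff: "f \<in> salg_carrier n \<longleftrightarrow> Poly_Mapping.keys f \<subseteq> mono_set n \<and> (\<forall>M. Poly_Mapping.lookup f M \<in> sym_polys n)"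
  unfolding salg_carrier_def by (auto simp: in_keys_iff)

lemma salg_carrier_add: "f \<in> salg_carrier n \<Longrightarrow> g \<in> salg_carrier n \<Longrightarrow> f + g \<in> salg_carrier n"
  using keys_add[of f g] by (auto simp: salg_carrier_iff lookup_add sym_polys_add)

lemma salg_carrier_0: "0 \<in> salg_carrier n" by (simp add: salg_carrier_iff)

lemma salg_carrier_sum: "(\<And>i. i \<in> I \<Longrightarrow> F i \<in> salg_carrier n) \<Longrightarrow> (\<Sum>i\<in>I. F i) \<in> salg_carrier n"
  by (induction I rule: infinite_finite_induct) (auto simp: salg_carrier_add salg_carrier_0)

lemma salg_carrier_single: "M \<in> mono_set n \<Longrightarrow> a \<in> sym_polys n \<Longrightarrow> Poly_Mapping.single M a \<in> salg_carrier n"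
  by (auto simp: salg_carrier_iff lookup_single when_def)

lemma mono_set_mult: "M \<in> mono_set n \<Longrightarrow> N \<in> mono_set n \<Longrightarrow> mono_mult M N \<in> mono_set n"
  using keys_add[of "snd (snd M)" "snd (snd N)"]
  by (cases M; cases N) (simp add: mono_set_def; blast)

lemma salg_carrier_mult: "f \<in> salg_carrier n \<Longrightarrow> g \<in> salg_carrier n \<Longrightarrow> f \<star> g \<in> salg_carrier n"
  unfolding salg_mult_def
  by (intro salg_carrier_sum salg_carrier_single mono_set_mult sym_polys_mult mono_sign_sym) (auto simp: salg_carrier_iff)

lemma salg_carrier_uminus: "f \<in> salg_carrier n \<Longrightarrow> - f \<in> salg_carrier n"
  by (auto simp: salg_carrier_iff sym_polys_uminus)

lemma Aprime_simps: "carrier (Aprime n) = salg_carrier n" "monoid.mult (Aprime n) = (\<star>)"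
  "\<one>\<^bsub>Aprime n\<^esub> = sconst 1" "\<zero>\<^bsub>Aprime n\<^esub> = 0" "add (Aprime n) = (+)"
  by (simp_all add: Aprime_def salg_carrier_def)

lemma ring_Aprime: "ring (Aprime n :: 'k::comm_ring_1 salg ring)"
proof (rule ringI)
  show "abelian_group (Aprime n :: 'k salg ring)"
  proof (rule abelian_groupI)
    show "\<exists>y\<in>carrier (Aprime n). y \<oplus>\<^bsub>Aprime n\<^esub> x = \<zero>\<^bsub>Aprime n\<^esub>" if "x \<in> carrier (Aprime n)" for x :: "'k salg"
      using that by (intro bexI[of _ "- x"]) (auto simp: Aprime_simps salg_carrier_uminus)
  qed (auto simp: Aprime_simps salg_carrier_add salg_carrier_0 add_ac)
  have "sconst 1 \<in> salg_carrier n" unfolding sconst_def by (intro salg_carrier_single) (auto simp: mono_set_def)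
  moreover have "(f \<star> g) \<star> h = f \<star> (g \<star> h)"
    if "f \<in> salg_carrier n" "g \<in> salg_carrier n" "h \<in> salg_carrier n" for f g h :: "'k salg"
    by (rule salg_mult_assoc[of _ n]) (use that in \<open>simp_all add: salg_carrier_iff\<close>)
  ultimately show "monoid (Aprime n :: 'k salg ring)"
    by unfold_locales (simp_all add: Aprime_simps salg_carrier_mult salg_mult_one)
qed (auto simp: Aprime_simps salg_mult_add_left salg_mult_add_right)

end

theory Submission
  imports Defs
begin

text \<open>
  Since the \<open>R\<^sub>l\<close> are central and homogeneous of weight \<open>(1, 1)\<close>, the saturation \<open>J'\<close> is the direct sum of
  its weight components. Those of weight \<open>(a, 0)\<close> and \<open>(0, b)\<close> vanish because \<open>\<Delta> \<noteq> 0\<close>, and the one of weight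
  \<open>(a, b)\<close> with \<open>a, b \<ge> 1\<close> is \<open>G\<^bsub>a,b\<^esub>\<close>. If \<open>a > n\<close> or \<open>b > n\<close>, replacing \<open>\<Delta>\<^sup>2W\<^sub>l\<close> by \<open>X\<^sup>TA\<^sub>lY\<close> kills every
  monomial of weight \<open>(a, b)\<close>, so that component is everything. Passing to \<open>A'/(e\<^sub>1, \<dots>, e\<^sub>n)\<close> replaces coefficients
  by their residues in \<open>k\<close>. That \<open>\<Lambda>\<^sub>n/(e\<^sub>1, \<dots>, e\<^sub>n) = k\<close> follows from Newton's identities, as the power sums
  generate \<open>\<Lambda>\<^sub>n\<close> when \<open>n!\<close> is invertible.
\<close>

section \<open>Symmetric polynomials\<close>

text \<open>That every residue is a scalar is reached without the fundamental theorem on symmetric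
  polynomials: averaging over all permutations writes \<open>n! p\<close> as a combination of orbit
  sums, and splitting off power sums puts each orbit sum with a positive exponent into the ideal. As
  \<open>red\<close> is a definite description, residues must also be unique; comparing constant
  terms gives this.

  A further obstacle is that coefficients have to be symmetric, while the entries of
  \<open>V\<close>, its determinant \<Delta> and its adjugate in general are not. Permuting the
  variables permutes the columns of \<open>V\<close>, so \<Delta> picks up a sign and the adjugate
  the same sign together with a permutation of its rows. In \<Delta> squared and in each
  \<open>A_l\<close> such factors occur in pairs and the signs cancel.

  Finally, multiplication by a relation shifts weights by exactly (1, 1). An equation expressing an
  element through the relations can therefore be compared coefficient by coefficient and splits into
  independent linear systems, one for each weight, whose matrices are the
  \<open>T_(a,b)\<close>.\<close>

definition tact :: "(nat \<Rightarrow> nat) \<Rightarrow> 'k::comm_ring_1 tpoly \<Rightarrow> 'k tpoly" where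
  "tact \<pi> p = Poly_Mapping.map_key (Poly_Mapping.map_key \<pi>) p"

definition tpolys :: "nat \<Rightarrow> 'k::comm_ring_1 tpoly set" where
  "tpolys n = {p. \<forall>m \<in> Poly_Mapping.keys p. Poly_Mapping.keys m \<subseteq> {1..n}}"

lemma lookup_tact:
  assumes "bij \<pi>"
  shows "Poly_Mapping.lookup (tact \<pi> p) m = Poly_Mapping.lookup p (Poly_Mapping.map_key \<pi> m)"
  using bij_map_key[OF assms] by (simp add: tact_def map_key.rep_eq bij_is_inj)

text \<open>Replaces the condition on coefficients by being fixed under ring homomorphisms, the form
  that applies to sums, products and determinants.\<close>

lemma sym_polys_iff:
  "p \<in> sym_polys n \<longleftrightarrow> p \<in> tpolys n \<and> (\<forall>\<pi>. \<pi> permutes {1..n} \<longrightarrow> tact \<pi> p = p)"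
  by (auto simp: sym_polys_def tpolys_def lookup_tact permutes_bij poly_mapping_eq_iff fun_eq_iff)

lemma tact_add: "bij \<pi> \<Longrightarrow> tact \<pi> (p + q) = tact \<pi> p + tact \<pi> q"
  by (rule poly_mapping_eqI) (simp add: lookup_tact lookup_add)

lemma tact_mult:
  assumes "bij \<pi>"
  shows "tact \<pi> (p * q) = tact \<pi> p * tact \<pi> q"
proof (rule poly_mapping_eqI)
  fix m :: "nat \<Rightarrow>\<^sub>0 nat"
  let ?k = "Poly_Mapping.map_key \<pi> :: (nat \<Rightarrow>\<^sub>0 nat) \<Rightarrow> _"
  have b: "bij ?k" using bij_map_key[OF assms] .
  have add: "?k (a + b) = ?k a + ?k b" for a b by (rule map_key_plus[OF bij_is_inj[OF assms]])
  have re: "(Sum_any g :: 'a) = Sum_any (\<lambda>l. g (?k l))" for g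
    by (rule Sum_any.reindex_cong[of ?k]) (use b in \<open>auto simp: bij_def comp_def\<close>)
  have "Poly_Mapping.lookup (p * q) (?k m) =
    Sum_any (\<lambda>l. Poly_Mapping.lookup p l * Sum_any (\<lambda>r. Poly_Mapping.lookup q r when ?k m = l + r))"
    by (rule lookup_mult)
  also have "\<dots> = Sum_any (\<lambda>l. Poly_Mapping.lookup p (?k l) * Sum_any (\<lambda>r. Poly_Mapping.lookup q (?k r) when ?k m = ?k l + ?k r))"
    by (subst re, subst (2) re) simp
  also have "\<dots> = Poly_Mapping.lookup (tact \<pi> p * tact \<pi> q) m"
    using b by (simp add: lookup_mult lookup_tact assms add[symmetric] bij_is_inj inj_eq)
  finally show "Poly_Mapping.lookup (tact \<pi> (p * q)) m = Poly_Mapping.lookup (tact \<pi> p * tact \<pi> q) m"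
    by (simp add: lookup_tact assms)
qed

lemma tact_const:
  assumes "bij \<pi>"
  shows "tact \<pi> (Poly_Mapping.single 0 c) = Poly_Mapping.single 0 c"
proof (rule poly_mapping_eqI)
  fix m :: "nat \<Rightarrow>\<^sub>0 nat"
  have "0 = Poly_Mapping.map_key \<pi> m \<longleftrightarrow> 0 = m"
    using bij_map_key[OF assms] map_key_zero[OF bij_is_inj[OF assms]] by (metis bij_pointE)
  then show "Poly_Mapping.lookup (tact \<pi> (Poly_Mapping.single 0 c)) m =
      Poly_Mapping.lookup (Poly_Mapping.single 0 c) m"
    by (simp add: lookup_tact assms lookup_single when_def)
qed

lemma comm_ring_hom_tact:
  assumes "bij \<pi>"
  shows "comm_ring_hom (tact \<pi> :: 'k::comm_ring_1 tpoly \<Rightarrow> _)"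
proof
  show "tact \<pi> 0 = (0 :: 'k tpoly)" "tact \<pi> 1 = (1 :: 'k tpoly)"
    using tact_const[OF assms, of "0::'k"] tact_const[OF assms, of "1::'k"] by simp_all
qed (simp_all add: assms tact_add tact_mult)

text \<open>Fixes the direction of the action: although exponent vectors are precomposed with \<pi>,
  the variables move forward along \<pi>.\<close>

lemma tact_tvar:
  assumes "bij \<pi>"
  shows "tact \<pi> (tvar i) = tvar (\<pi> i)"
proof (rule poly_mapping_eqI)
  fix m :: "nat \<Rightarrow>\<^sub>0 nat"
  have "Poly_Mapping.map_key \<pi> (Poly_Mapping.single (\<pi> i) (1::nat)) = Poly_Mapping.single i 1"
    using assms by (intro poly_mapping_eqI)
      (auto simp: map_key.rep_eq lookup_single when_def bij_is_inj inj_eq)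
  then have "Poly_Mapping.single i 1 = Poly_Mapping.map_key \<pi> m \<longleftrightarrow> Poly_Mapping.single (\<pi> i) 1 = m"
    using bij_map_key[OF assms] by (metis bij_pointE)
  then show "Poly_Mapping.lookup (tact \<pi> (tvar i)) m = Poly_Mapping.lookup (tvar (\<pi> i) :: 'a tpoly) m"
    by (auto simp: lookup_tact assms tvar_def lookup_single when_def)
qed

lemma tpolys_add: "p \<in> tpolys n \<Longrightarrow> q \<in> tpolys n \<Longrightarrow> p + q \<in> tpolys n"
  using keys_add[of p q] by (simp add: tpolys_def) blast

lemma tpolys_mult:
  assumes "p \<in> tpolys n" "q \<in> tpolys n"
  shows "p * q \<in> tpolys n"
  unfolding tpolys_def
proof safe
  fix m x assume m: "m \<in> Poly_Mapping.keys (p * q)" "x \<in> Poly_Mapping.keys m"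
  obtain a b where ab: "m = a + b" "a \<in> Poly_Mapping.keys p" "b \<in> Poly_Mapping.keys q"
    using m keys_mult[of p q] by auto
  have "x \<in> Poly_Mapping.keys a \<union> Poly_Mapping.keys b"
    using m keys_add[of a b] ab(1) by blast
  then show "x \<in> {1..n}" using assms ab unfolding tpolys_def by blast
qed

lemma tpolys_const: "Poly_Mapping.single 0 c \<in> tpolys n"
  by (auto simp: tpolys_def split: if_splits)

lemma tpolys_0_1: "0 \<in> tpolys n" "1 \<in> tpolys n"
  using tpolys_const[of 0] tpolys_const[of 1] by simp_all

lemma tpolys_uminus: "p \<in> tpolys n \<Longrightarrow> - p \<in> tpolys n"
  by (simp add: tpolys_def)

lemma tpolys_sum: "(\<And>i. i \<in> I \<Longrightarrow> F i \<in> tpolys n) \<Longrightarrow> (\<Sum>i\<in>I. F i) \<in> tpolys n"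
  by (induction I rule: infinite_finite_induct) (auto simp: tpolys_add tpolys_0_1)

lemma tpolys_prod: "(\<And>i. i \<in> I \<Longrightarrow> F i \<in> tpolys n) \<Longrightarrow> (\<Prod>i\<in>I. F i) \<in> tpolys n"
  by (induction I rule: infinite_finite_induct) (auto simp: tpolys_mult tpolys_0_1)

lemma tpolys_power: "p \<in> tpolys n \<Longrightarrow> p ^ k \<in> tpolys n"
  by (induction k) (auto simp: tpolys_mult tpolys_0_1)

lemma tpolys_tvar: "i \<in> {1..n} \<Longrightarrow> tvar i \<in> tpolys n"
  by (auto simp: tpolys_def tvar_def)

lemma tpolys_det:
  assumes "\<And>i j. i < dim_row A \<Longrightarrow> j < dim_row A \<Longrightarrow> A $$ (i, j) \<in> tpolys n"
  shows "det A \<in> tpolys n"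
proof -
  have "signof p * (\<Prod>i = 0..<dim_row A. A $$ (i, p i)) \<in> tpolys n"
    if "p permutes {0..<dim_row A}" for p
  proof (intro tpolys_mult tpolys_prod)
    show "(signof p :: 'a tpoly) \<in> tpolys n"
      by (auto simp: sign_def tpolys_0_1 tpolys_uminus)
    show "A $$ (i, p i) \<in> tpolys n" if "i \<in> {0..<dim_row A}" for i
      using that permutes_in_image[OF \<open>p permutes _\<close>, of i] by (intro assms) auto
  qed
  then show ?thesis by (auto simp: det_def tpolys_0_1 intro!: tpolys_sum)
qed

lemma sym_polys_diff: "p \<in> sym_polys n \<Longrightarrow> q \<in> sym_polys n \<Longrightarrow> p - q \<in> sym_polys n"
  using sym_polys_add[of p n "- q"] sym_polys_uminus[of q n] by simp

lemma sym_polys_sum: "(\<And>i. i \<in> I \<Longrightarrow> F i \<in> sym_polys n) \<Longrightarrow> (\<Sum>i\<in>I. F i) \<in> sym_polys n"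
  by (induction I rule: infinite_finite_induct) (auto simp: sym_polys_add)

lemma sym_polys_power: "p \<in> sym_polys n \<Longrightarrow> p ^ k \<in> sym_polys n"
  by (induction k) (auto simp: sym_polys_mult)

lemma tact_sum:
  assumes "bij \<pi>"
  shows "tact \<pi> (sum F I) = (\<Sum>i\<in>I. tact \<pi> (F i))"
proof -
  interpret comm_ring_hom "tact \<pi>" by (rule comm_ring_hom_tact[OF assms])
  show ?thesis by (rule hom_sum)
qed

lemma tact_prod:
  assumes "bij \<pi>"
  shows "tact \<pi> (prod F I) = (\<Prod>i\<in>I. tact \<pi> (F i))"
proof -
  interpret comm_ring_hom "tact \<pi>" by (rule comm_ring_hom_tact[OF assms])
  show ?thesis by (rule hom_prod)
qed

lemma tact_power: "bij \<pi> \<Longrightarrow> tact \<pi> (p ^ k) = tact \<pi> p ^ k"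
  using tact_prod[of \<pi> "\<lambda>_. p" "{..<k}"] by simp

lemma esym_sym: "esym n l \<in> sym_polys n"
  unfolding sym_polys_iff
proof (intro conjI allI impI)
  show "esym n l \<in> tpolys n"
    unfolding esym_def by (intro tpolys_sum tpolys_prod tpolys_tvar) auto
next
  fix \<pi> assume pi: "\<pi> permutes {1..n}"
  then have i: "inj_on \<pi> S" for S using permutes_inj inj_on_subset by blast
  have "tact \<pi> (esym n l :: 'a tpoly) = (\<Sum>S | S \<subseteq> {1..n} \<and> card S = l. \<Prod>i\<in>S. tvar (\<pi> i))"
    using pi by (simp add: esym_def tact_sum tact_prod tact_tvar permutes_bij)
  also have "\<dots> = (\<Sum>S | S \<subseteq> {1..n} \<and> card S = l. \<Prod>i\<in>\<pi> ` S. tvar i)"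
    by (simp add: prod.reindex i)
  also have "\<dots> = esym n l"
    unfolding esym_def
  proof (rule sum.reindex_bij_witness[where i = "\<lambda>S. inv_into UNIV \<pi> ` S" and j = "\<lambda>S. \<pi> ` S"], goal_cases)
    case (4 S)
    have "inj_on (inv_into UNIV \<pi>) S"
      using permutes_inj[OF permutes_inv[OF pi]] inj_on_subset by blast
    then show ?case using 4 permutes_in_image[OF permutes_inv[OF pi]] by (auto simp: card_image)
  next
    case (3 S) then show ?case by (simp add: image_image permutes_inverses[OF pi])
  next
    case (2 S) then show ?case using permutes_in_image[OF pi] by (auto simp: card_image i)
  qed (auto simp: image_image permutes_inverses[OF pi])
  finally show "tact \<pi> (esym n l) = (esym n l :: 'a tpoly)" .
qed

lemma sum_tvar_power_sym: "(\<Sum>i\<in>{1..n}. tvar i ^ k) \<in> sym_polys n"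
  unfolding sym_polys_iff
proof (intro conjI allI impI)
  show "(\<Sum>i\<in>{1..n}. tvar i ^ k) \<in> tpolys n"
    by (intro tpolys_sum tpolys_power tpolys_tvar)
next
  fix \<pi> assume pi: "\<pi> permutes {1..n}"
  have "tact \<pi> (\<Sum>i\<in>{1..n}. tvar i ^ k :: 'a tpoly) = (\<Sum>i\<in>{1..n}. tvar (\<pi> i) ^ k)"
    using pi by (simp add: tact_sum tact_power tact_tvar permutes_bij)
  also have "\<dots> = (\<Sum>i\<in>{1..n}. tvar i ^ k)"
    using sum.permute[OF pi, of "\<lambda>i. tvar i ^ k :: 'a tpoly"] by (simp only: comp_def)
  finally show "tact \<pi> (\<Sum>i\<in>{1..n}. tvar i ^ k) = (\<Sum>i\<in>{1..n}. tvar i ^ k :: 'a tpoly)" .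
qed

section \<open>The ideal of \<open>Lam n\<close> generated by the elementary symmetric
  polynomials\<close>

lemma Lam_idealI:
  fixes I :: "'k::comm_ring_1 tpoly set"
  assumes "I \<subseteq> sym_polys n" "0 \<in> I" "\<And>p q. p \<in> I \<Longrightarrow> q \<in> I \<Longrightarrow> p + q \<in> I"
    "\<And>p q. p \<in> I \<Longrightarrow> q \<in> sym_polys n \<Longrightarrow> q * p \<in> I"
  shows "ideal I (Lam n)"
proof (rule idealI[OF cring.axioms(1)[OF cring_Lam]])
  have grp: "Group.group (add_monoid (Lam n :: 'k tpoly ring))"
    using abelian_group.a_group[OF ring.axioms(1)[OF cring.axioms(1)[OF cring_Lam]]] .
  show "subgroup I (add_monoid (Lam n))"
  proof (rule group.subgroupI[OF grp])
    fix p :: "'k tpoly" assume p: "p \<in> I"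
    have "-1 * p \<in> I" by (intro assms(4) p sym_polys_uminus sym_polys_1)
    then have mp: "- p \<in> I" by simp
    have "inv\<^bsub>add_monoid (Lam n)\<^esub> p = - p"
      by (rule group.inv_equality[OF grp]) (use p mp assms(1) in \<open>auto simp: Lam_def\<close>)
    then show "inv\<^bsub>add_monoid (Lam n)\<^esub> p \<in> I" using mp by simp
  qed (use assms in \<open>auto simp: Lam_def\<close>)
next
  fix p q :: "'k tpoly" assume "p \<in> I" "q \<in> carrier (Lam n)"
  then show "q \<otimes>\<^bsub>Lam n\<^esub> p \<in> I" "p \<otimes>\<^bsub>Lam n\<^esub> q \<in> I"
    using assms(4)[of p q] by (simp_all add: Lam_def mult.commute)
qed

text \<open>The ideal modulo which \<open>red\<close> takes residues.\<close>

definition Epoly :: "nat \<Rightarrow> 'k::comm_ring_1 tpoly set" where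
  "Epoly n = Idl\<^bsub>Lam n\<^esub> (esym n ` {1..n})"

lemma Epoly_ideal: "ideal (Epoly n :: 'k::comm_ring_1 tpoly set) (Lam n)"
  unfolding Epoly_def using esym_sym
  by (intro ring.genideal_ideal cring.axioms(1)[OF cring_Lam]) (auto simp: Lam_def)

lemma Epoly_0: "0 \<in> Epoly n"
  using additive_subgroup.zero_closed[OF ideal.axioms(1)[OF Epoly_ideal]] by (simp add: Lam_def)

lemma Epoly_add: "p \<in> Epoly n \<Longrightarrow> q \<in> Epoly n \<Longrightarrow> p + q \<in> Epoly n"
  using additive_subgroup.a_closed[OF ideal.axioms(1)[OF Epoly_ideal]] by (simp add: Lam_def)

lemma Epoly_mult: "p \<in> Epoly n \<Longrightarrow> q \<in> sym_polys n \<Longrightarrow> q * p \<in> Epoly n"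
  using ideal.I_l_closed[OF Epoly_ideal] by (simp add: Lam_def)

lemma Epoly_uminus:
  assumes "p \<in> Epoly n"
  shows "- p \<in> Epoly n"
  using Epoly_mult[OF assms, of "-1"] sym_polys_uminus[OF sym_polys_1, of n] by simp

lemma Epoly_diff: "p \<in> Epoly n \<Longrightarrow> q \<in> Epoly n \<Longrightarrow> p - q \<in> Epoly n"
  using Epoly_add[of p n "- q"] Epoly_uminus[of q n] by simp

lemma Epoly_sum: "(\<And>i. i \<in> I \<Longrightarrow> F i \<in> Epoly n) \<Longrightarrow> (\<Sum>i\<in>I. F i) \<in> Epoly n"
  by (induction I rule: infinite_finite_induct) (auto simp: Epoly_add Epoly_0)

text \<open>For \<open>l > n\<close> the sum is empty, so the element is 0. Allowing these indices
  frees Newton's identities from range conditions.\<close>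

lemma Epoly_esym:
  assumes "l \<ge> 1"
  shows "esym n l \<in> Epoly n"
proof (cases "l \<le> n")
  case True
  then have "esym n ` {1..n} \<subseteq> carrier (Lam n)" "esym n l \<in> esym n ` {1..n}"
    using assms esym_sym by (auto simp: Lam_def)
  then show ?thesis unfolding Epoly_def using ring.genideal_self[OF cring.axioms(1)[OF cring_Lam]] by blast
next
  case False
  then have "{S. S \<subseteq> {1..n} \<and> card S = l} = {}"
    using card_mono[of "{1..n}"] by fastforce
  then show ?thesis unfolding esym_def by (simp only: sum.empty Epoly_0)
qed

text \<open>Generalises \<open>esym\<close> from \<open>{1..n}\<close> to any index set, because
  Newton's identities omit one variable at a time.\<close>

definition esum :: "nat set \<Rightarrow> nat \<Rightarrow> 'k::comm_ring_1 tpoly" where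
  "esum J r = (\<Sum>S | S \<subseteq> J \<and> card S = r. \<Prod>i\<in>S. tvar i)"

lemma esum_0: "finite J \<Longrightarrow> esum J 0 = 1"
proof -
  assume "finite J"
  then have "{S. S \<subseteq> J \<and> card S = 0} = {{}}" by (auto dest: finite_subset)
  then show ?thesis by (simp add: esum_def)
qed

text \<open>The subsets of size \<open>Suc r\<close> are sorted by whether they contain
  \<open>j\<close>; those that do arise uniquely by inserting \<open>j\<close> into a subset of size
  \<open>r\<close>.\<close>

lemma esum_remove:
  assumes "finite J" "j \<in> J"
  shows "(esum J (Suc r) :: 'k::comm_ring_1 tpoly) = esum (J - {j}) (Suc r) + tvar j * esum (J - {j}) r"
proof -
  let ?A = "{S. S \<subseteq> J - {j} \<and> card S = Suc r}" and ?B = "{S. S \<subseteq> J - {j} \<and> card S = r}"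
  have fin: "finite ?A" "finite ?B" using assms by auto
  have fS: "finite S \<and> j \<notin> S" if "S \<in> ?B" for S using that assms finite_subset by auto
  have inj: "inj_on (insert j) ?B" by (auto simp: inj_on_def)
  have "{S. S \<subseteq> J \<and> card S = Suc r} = ?A \<union> insert j ` ?B"
  proof (intro equalityI subsetI)
    fix S assume S: "S \<in> {S. S \<subseteq> J \<and> card S = Suc r}"
    show "S \<in> ?A \<union> insert j ` ?B"
    proof (cases "j \<in> S")
      case True
      have "finite S" using S assms finite_subset by auto
      then have "S = insert j (S - {j})" "S - {j} \<in> ?B" using S True by auto
      then show ?thesis by blast
    qed (use S in auto)
  next
    fix S assume "S \<in> ?A \<union> insert j ` ?B"
    then consider "S \<in> ?A" | S' where "S' \<in> ?B" "S = insert j S'" by blast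
    then show "S \<in> {S. S \<subseteq> J \<and> card S = Suc r}"
    proof cases
      case 2
      then show ?thesis using fS[of S'] assms(2) by auto
    qed auto
  qed
  moreover have "?A \<inter> insert j ` ?B = {}" by auto
  ultimately have "(esum J (Suc r) :: 'k tpoly) = esum (J - {j}) (Suc r) + (\<Sum>S\<in>insert j ` ?B. \<Prod>i\<in>S. tvar i)"
    using fin by (simp add: esum_def sum.union_disjoint)
  also have "(\<Sum>S\<in>insert j ` ?B. \<Prod>i\<in>S. tvar i :: 'k tpoly) = (\<Sum>S\<in>?B. tvar j * (\<Prod>i\<in>S. tvar i))"
    unfolding sum.reindex[OF inj] comp_apply
    by (rule sum.cong[OF refl], rule prod.insert) (use fS in blast)+
  finally show ?thesis by (simp add: esum_def sum_distrib_left)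
qed

text \<open>Double counting: the product over \<open>S\<close> occurs once for each \<open>j\<close>
  outside \<open>S\<close>. The truncated subtraction is harmless, since for
  \<open>r > card J\<close> there is no such \<open>S\<close> and both sides are 0.\<close>

lemma sum_esum_remove:
  assumes "finite J"
  shows "(\<Sum>j\<in>J. esum (J - {j}) r :: 'k::comm_ring_1 tpoly) = of_nat (card J - r) * esum J r"
proof -
  let ?P = "{S. S \<subseteq> J \<and> card S = r}" and ?F = "\<lambda>S. \<Prod>i\<in>S. tvar i :: 'k tpoly"
  have "(\<Sum>j\<in>J. esum (J - {j}) r) = (\<Sum>j\<in>J. \<Sum>S | S \<in> ?P \<and> j \<notin> S. ?F S)"
    unfolding esum_def by (intro sum.cong refl) auto
  also have "\<dots> = (\<Sum>S\<in>?P. \<Sum>j | j \<in> J \<and> j \<notin> S. ?F S)"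
    by (rule sum.swap_restrict) (use assms in auto)
  also have "\<dots> = (\<Sum>S\<in>?P. of_nat (card J - r) * ?F S)"
  proof (rule sum.cong[OF refl])
    fix S assume S: "S \<in> ?P"
    have "{j \<in> J. j \<notin> S} = J - S" by auto
    then show "(\<Sum>j | j \<in> J \<and> j \<notin> S. ?F S) = of_nat (card J - r) * ?F S"
      using S assms finite_subset[of S J] by (simp add: card_Diff_subset)
  qed
  finally show ?thesis by (simp add: esum_def sum_distrib_left)
qed

text \<open>
  Newton's identities: \<open>p\<^sub>k e\<^bsub>r+1\<^esub> = h\<^bsub>k,r+1\<^esub> + h\<^bsub>k+1,r\<^esub>\<close> for the sums \<open>h\<^bsub>k,r\<^esub>\<close> of all \<open>t\<^sub>j\<^sup>k e\<^sub>r(t without t\<^sub>j)\<close>.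
\<close>

lemma sum_power_esum_in_Epoly:
  "(\<Sum>j\<in>{1..n}. tvar j ^ Suc k * esum ({1..n} - {j}) r) \<in> (Epoly n :: 'k::comm_ring_1 tpoly set)"
proof (induction k arbitrary: r)
  have step: "(\<Sum>j\<in>{1..n}. tvar j ^ Suc k * esum ({1..n} - {j}) r :: 'k tpoly) =
      (\<Sum>j\<in>{1..n}. tvar j ^ k) * esym n (Suc r) -
      (\<Sum>j\<in>{1..n}. tvar j ^ k * esum ({1..n} - {j}) (Suc r))" for k r
    unfolding sum_distrib_right sum_subtractf[symmetric]
  proof (rule sum.cong[OF refl])
    fix j assume "j \<in> {1..n}"
    then have "(esym n (Suc r) :: 'k tpoly) = esum ({1..n} - {j}) (Suc r) + tvar j * esum ({1..n} - {j}) r"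
      using esum_remove[of "{1..n}" j r] by (simp add: esum_def esym_def)
    then show "(tvar j ^ Suc k * esum ({1..n} - {j}) r :: 'k tpoly) =
      tvar j ^ k * esym n (Suc r) - tvar j ^ k * esum ({1..n} - {j}) (Suc r)"
      by (simp add: algebra_simps)
  qed
  have pe: "(\<Sum>j\<in>{1..n}. tvar j ^ k) * esym n (Suc r) \<in> (Epoly n :: 'k tpoly set)" for k r
    by (intro Epoly_mult Epoly_esym sum_tvar_power_sym) simp
  {
    \<comment> \<open>The recursion lowers the exponent and raises \<open>r\<close>, hence the
      induction over arbitrary \<open>r\<close>. At exponent 0 it ends in a sum that double counting
      turns into a multiple of an elementary symmetric polynomial.\<close>
    case 0
    have "(\<Sum>j\<in>{1..n}. esum ({1..n} - {j}) (Suc r) :: 'k tpoly) = of_nat (n - Suc r) * esym n (Suc r)"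
      by (subst sum_esum_remove) (simp_all add: esum_def esym_def)
    moreover have "(of_nat (n - Suc r) :: 'k tpoly) \<in> sym_polys n"
      unfolding of_nat_single comp_apply by (rule sym_polys_const)
    ultimately have "(\<Sum>j\<in>{1..n}. esum ({1..n} - {j}) (Suc r)) \<in> (Epoly n :: 'k tpoly set)"
      by (simp add: Epoly_mult Epoly_esym)
    then show ?case unfolding step using pe[of 0 r] by (intro Epoly_diff) simp_all
  next
    case (Suc k)
    show ?case by (subst step) (intro Epoly_diff pe Suc)
  }
qed

text \<open>The case \<open>r = 0\<close>, in which the factor omitting \<open>j\<close> is
  1.\<close>

lemma sum_power_in_Epoly:
  assumes "k \<ge> 1"
  shows "(\<Sum>j\<in>{1..n}. tvar j ^ k) \<in> Epoly n"
  using sum_power_esum_in_Epoly[where n = n and k = "k - 1" and r = 0] assms by (simp add: esum_0)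

section \<open>Orbit sums expressed through power sums\<close>

definition injections :: "nat \<Rightarrow> nat set \<Rightarrow> (nat \<Rightarrow> nat) set" where
  "injections n A = {f \<in> A \<rightarrow>\<^sub>E {1..n}. inj_on f A}"

text \<open>An integer multiple of the monomial symmetric polynomial with exponents
  \<open>m\<close>. Summing over injections instead of distinct monomials keeps the recursion below
  free of multiplicities and of division.\<close>

definition injsum :: "nat \<Rightarrow> nat set \<Rightarrow> (nat \<Rightarrow> nat) \<Rightarrow> 'k::comm_ring_1 tpoly" where
  "injsum n A m = (\<Sum>f\<in>injections n A. \<Prod>a\<in>A. tvar (f a) ^ m a)"

text \<open>Multiplying by the power sum assigns an arbitrary value \<open>j\<close> to
  \<open>x\<close>. If \<open>j\<close> is new, this extends the injection; otherwise
  \<open>j\<close> is the value at exactly one \<open>a\<close> in \<open>A\<close>, and the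
  exponents of \<open>a\<close> and \<open>x\<close> add up.\<close>

lemma injsum_insert:
  assumes "finite A" "x \<notin> A"
  shows "(injsum n (insert x A) m :: 'k::comm_ring_1 tpoly) =
    (\<Sum>j\<in>{1..n}. tvar j ^ m x) * injsum n A m - (\<Sum>a\<in>A. injsum n A (m(a := m a + m x)))"
proof -
  let ?F = "\<lambda>f. \<Prod>a\<in>A. tvar (f a) ^ m a :: 'k tpoly"
  have finj: "finite (injections n A)"
    unfolding injections_def
    by (rule finite_subset[of _ "A \<rightarrow>\<^sub>E {1..n}"]) (use assms in \<open>auto intro: finite_PiE\<close>)
  let ?D = "SIGMA g:injections n A. {1..n} - g ` A"
  have "injections n (insert x A) =
      (\<lambda>z. (snd z)(x := fst z)) ` {(y, g). y \<in> {1..n} \<and> g \<in> A \<rightarrow>\<^sub>E {1..n} - {y} \<and> inj_on g A}"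
    using extensional_funcset_extend_domain_inj_on_eq[OF assms(2), of "{1..n}"]
    by (simp only: injections_def case_prod_unfold)
  also have "{(y, g). y \<in> {1..n} \<and> g \<in> A \<rightarrow>\<^sub>E {1..n} - {y} \<and> inj_on g A} = prod.swap ` ?D"
    unfolding injections_def by (force simp: PiE_iff)
  finally have eq: "injections n (insert x A) = (\<lambda>(g, y). g(x := y)) ` ?D"
    by (simp only: image_image case_prod_unfold fst_swap snd_swap)
  have inj: "inj_on (\<lambda>(g, y). g(x := y)) ?D"
  proof (rule inj_onI, safe)
    fix g y g' y' assume g: "g \<in> injections n A" "g' \<in> injections n A" "g(x := y) = g'(x := y')"
    show "y = y'" using g(3) by (metis fun_upd_same)
    show "g = g'"
    proof
      fix a
      \<comment> \<open>Members of \<open>injections n A\<close> are extensional and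
        \<open>x\<close> is not in \<open>A\<close>, so the value overwritten at \<open>x\<close>
        was the same default for both.\<close>
      have "g x = undefined" "g' x = undefined" 
        using g(1,2) assms by (auto simp: injections_def PiE_def extensional_def)
      then show "g a = g' a" using g(3) by (metis fun_upd_apply)
    qed
  qed
  have "(injsum n (insert x A) m :: 'k tpoly) = (\<Sum>(g, y)\<in>?D. tvar y ^ m x * ?F g)"
    unfolding injsum_def eq
    sum.reindex[OF inj] comp_apply
  proof (rule sum.cong[OF refl], safe)
    fix g y
    have "(\<Prod>a\<in>A. tvar ((g(x := y)) a) ^ m a) = ?F g"
      by (rule prod.cong) (use assms in auto)
    then show "(\<Prod>a\<in>insert x A. tvar ((g(x := y)) a) ^ m a) = tvar y ^ m x * ?F g"
      using assms by simp
  qed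
  also have "\<dots> = (\<Sum>g\<in>injections n A. \<Sum>y\<in>{1..n} - g ` A. tvar y ^ m x * ?F g)"
    by (rule sum.Sigma[symmetric]) (use finj in auto)
  also have "\<dots> = (\<Sum>g\<in>injections n A. (\<Sum>j\<in>{1..n}. tvar j ^ m x) * ?F g -
      (\<Sum>a\<in>A. \<Prod>b\<in>A. tvar (g b) ^ (m(a := m a + m x)) b))"
  proof (rule sum.cong[OF refl])
    fix g assume g: "g \<in> injections n A"
    then have sub: "g ` A \<subseteq> {1..n}" and ginj: "inj_on g A" by (auto simp: injections_def)
    have "(\<Sum>y\<in>{1..n} - g ` A. tvar y ^ m x * ?F g) =
        (\<Sum>y\<in>{1..n}. tvar y ^ m x * ?F g) - (\<Sum>y\<in>g ` A. tvar y ^ m x * ?F g)"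
      by (rule sum_diff) (use sub in auto)
    also have "(\<Sum>y\<in>g ` A. tvar y ^ m x * ?F g) = (\<Sum>a\<in>A. tvar (g a) ^ m x * ?F g)"
      by (simp add: sum.reindex[OF ginj])
    also have "\<dots> = (\<Sum>a\<in>A. \<Prod>b\<in>A. tvar (g b) ^ (m(a := m a + m x)) b)"
    proof (rule sum.cong[OF refl])
      fix a assume "a \<in> A"
      moreover have "(\<Prod>b\<in>A-{a}. tvar (g b) ^ (m(a := m a + m x)) b :: 'k tpoly) = (\<Prod>b\<in>A-{a}. tvar (g b) ^ m b)"
        by (rule prod.cong) auto
      ultimately show "tvar (g a) ^ m x * ?F g = (\<Prod>b\<in>A. tvar (g b) ^ (m(a := m a + m x)) b)"
        using assms by (simp add: prod.remove[of A a] power_add mult_ac)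
    qed
    finally show "(\<Sum>y\<in>{1..n} - g ` A. tvar y ^ m x * ?F g) =
       (\<Sum>j\<in>{1..n}. tvar j ^ m x) * ?F g - (\<Sum>a\<in>A. \<Prod>b\<in>A. tvar (g b) ^ (m(a := m a + m x)) b)"
      by (simp add: sum_distrib_right)
  qed
  also have "\<dots> = (\<Sum>j\<in>{1..n}. tvar j ^ m x) * injsum n A m - (\<Sum>a\<in>A. injsum n A (m(a := m a + m x)))"
    unfolding injsum_def sum_subtractf sum_distrib_left[symmetric] by (subst (2) sum.swap) simp
  finally show ?thesis .
qed

text \<open>By the recursion, an orbit sum is an integer polynomial in power sums.\<close>

lemma injsum_sym: "finite A \<Longrightarrow> (injsum n A m :: 'k::comm_ring_1 tpoly) \<in> sym_polys n"
proof (induction A arbitrary: m rule: finite_induct)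
  case empty
  have "injections n {} = {\<lambda>_. undefined}" by (auto simp: injections_def)
  then show ?case by (simp add: injsum_def)
next
  case (insert x A)
  show ?case
    unfolding injsum_insert[OF insert.hyps(1,2)]
    by (intro sym_polys_diff sym_polys_mult sym_polys_sum sum_tvar_power_sym insert.IH)
qed

text \<open>The recursion is applied with \<open>a\<close> as the element split off. The power sum
  of exponent \<open>m a\<close> lies in the ideal; in every other term the exponent at some
  \<open>b\<close> is \<open>m b + m a\<close>, still positive, so the induction hypothesis applies
  with \<open>b\<close> as witness.\<close>

lemma injsum_in_Epoly:
  assumes "finite A" "a \<in> A" "m a \<ge> 1"
  shows "injsum n A m \<in> (Epoly n :: 'k::comm_ring_1 tpoly set)"
  using assms
proof (induction "card A" arbitrary: A m a)
  case (Suc c)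
  define B where "B = A - {a}"
  have A: "A = insert a B" "a \<notin> B" "finite B" "card B = c"
    using Suc by (auto simp: B_def)
  have "(\<Sum>j\<in>{1..n}. tvar j ^ m a) * injsum n B m \<in> (Epoly n :: 'k tpoly set)"
    using Epoly_mult[OF sum_power_in_Epoly[OF Suc.prems(3)] injsum_sym[OF A(3)]]
    by (simp only: mult.commute)
  moreover have "injsum n B (m(b := m b + m a)) \<in> (Epoly n :: 'k tpoly set)" if "b \<in> B" for b
    by (rule Suc.hyps(1)[OF A(4)[symmetric] A(3) that]) (use Suc.prems in simp)
  ultimately show ?case
    unfolding A(1) injsum_insert[OF A(3,2)] by (intro Epoly_diff Epoly_sum)
qed auto

lemma tvar_power: "tvar a ^ k = (Poly_Mapping.single (Poly_Mapping.single a k) 1 :: 'k::comm_ring_1 tpoly)"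
  by (induction k) (simp_all add: tvar_def mult_single single_add[symmetric])

lemma prod_single:
  "(\<Prod>a\<in>A. Poly_Mapping.single (f a) 1) = (Poly_Mapping.single (\<Sum>a\<in>A. f a) 1 :: 'k::comm_ring_1 tpoly)"
  by (induction A rule: infinite_finite_induct) (simp_all add: mult_single)

lemma single_eq_prod_tvar:
  assumes "Poly_Mapping.keys m \<subseteq> {1..n}"
  shows "(Poly_Mapping.single m 1 :: 'k::comm_ring_1 tpoly) = (\<Prod>a\<in>{1..n}. tvar a ^ Poly_Mapping.lookup m a)"
proof -
  have "(\<Sum>a\<in>{1..n}. Poly_Mapping.single a (Poly_Mapping.lookup m a)) = m"
  proof (rule poly_mapping_eqI)
    fix x
    show "Poly_Mapping.lookup (\<Sum>a\<in>{1..n}. Poly_Mapping.single a (Poly_Mapping.lookup m a)) x = Poly_Mapping.lookup m x"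
      using assms by (cases "x \<in> {1..n}") (auto simp: lookup_sum lookup_single when_def in_keys_iff subset_iff)
  qed
  then show ?thesis by (simp add: tvar_power prod_single)
qed

text \<open>An injection of a finite set into itself is a permutation. The two encodings differ only
  outside \<open>{1..n}\<close>: extensional functions are \<open>undefined\<close> there,
  permutations are the identity.\<close>

lemma injsum_eq_permutations:
  "(injsum n {1..n} m :: 'k::comm_ring_1 tpoly) = (\<Sum>\<pi> | \<pi> permutes {1..n}. \<Prod>a\<in>{1..n}. tvar (\<pi> a) ^ m a)"
  unfolding injsum_def
proof (rule sum.reindex_bij_witness[where j = "\<lambda>f x. if x \<in> {1..n} then f x else x"
      and i = "\<lambda>\<pi>. restrict \<pi> {1..n}"], goal_cases)
  case (1 f)
  then show ?case by (auto simp: injections_def PiE_def extensional_def restrict_def)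
next
  case (2 f)
  then have "f ` {1..n} \<subseteq> {1..n}" "inj_on f {1..n}" by (auto simp: injections_def)
  then have "bij_betw f {1..n} {1..n}" by (simp add: bij_betw_def endo_inj_surj)
  then have "bij_betw (\<lambda>x. if x \<in> {1..n} then f x else x) {1..n} {1..n}"
    by (rule bij_betw_cong[THEN iffD1, rotated]) simp
  then have "(\<lambda>x. if x \<in> {1..n} then f x else x) permutes {1..n}"
    by (rule bij_imp_permutes) auto
  then show ?case by simp
next
  case (3 \<pi>)
  then show ?case by (auto simp: permutes_def)
next
  case (4 \<pi>)
  then show ?case
    using permutes_in_image[of \<pi> "{1..n}"] permutes_inj_on[of \<pi> "{1..n}" "{1..n}"]
    by (auto simp: injections_def)
next
  case (5 f)
  show ?case by (rule prod.cong) simp_all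
qed

text \<open>Both sides are the sum of \<open>p\<close> over all permutations of its variables.\<close>

lemma fact_mult_sym_poly:
  assumes "(p :: 'k::comm_ring_1 tpoly) \<in> sym_polys n"
  shows "of_nat (fact n) * p = (\<Sum>m\<in>Poly_Mapping.keys p.
    Poly_Mapping.single 0 (Poly_Mapping.lookup p m) * injsum n {1..n} (Poly_Mapping.lookup m))"
proof -
  let ?P = "{\<pi>. \<pi> permutes {1..n}}"
  let ?c = "\<lambda>m. Poly_Mapping.single 0 (Poly_Mapping.lookup p m) :: 'k tpoly"
  have p: "p = (\<Sum>m\<in>Poly_Mapping.keys p. ?c m * (\<Prod>a\<in>{1..n}. tvar a ^ Poly_Mapping.lookup m a))"
  proof -
    have "p = (\<Sum>m\<in>Poly_Mapping.keys p. Poly_Mapping.single m (Poly_Mapping.lookup p m))"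
      by (rule poly_mapping_eqI) (auto simp: lookup_sum lookup_single when_def in_keys_iff sum.delta)
    also have "\<dots> = (\<Sum>m\<in>Poly_Mapping.keys p. ?c m * (\<Prod>a\<in>{1..n}. tvar a ^ Poly_Mapping.lookup m a))"
    proof (rule sum.cong[OF refl])
      fix m assume "m \<in> Poly_Mapping.keys p"
      then have "Poly_Mapping.keys m \<subseteq> {1..n}" using assms by (simp add: sym_polys_def)
      from single_eq_prod_tvar[OF this, where 'k = 'k, symmetric]
      show "Poly_Mapping.single m (Poly_Mapping.lookup p m) = ?c m * (\<Prod>a\<in>{1..n}. tvar a ^ Poly_Mapping.lookup m a)"
        by (simp only: mult_single) simp
    qed
    finally show ?thesis .
  qed
  have "of_nat (fact n) * p = (\<Sum>\<pi>\<in>?P. p)"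
    by (simp add: card_permutations)
  also have "\<dots> = (\<Sum>\<pi>\<in>?P. tact \<pi> p)"
    using assms by (intro sum.cong) (auto simp: sym_polys_iff)
  also have "\<dots> = (\<Sum>\<pi>\<in>?P. \<Sum>m\<in>Poly_Mapping.keys p. ?c m * (\<Prod>a\<in>{1..n}. tvar (\<pi> a) ^ Poly_Mapping.lookup m a))"
  proof (rule sum.cong[OF refl])
    fix \<pi> assume "\<pi> \<in> ?P"
    then have b: "bij \<pi>" by (simp add: permutes_bij)
    show "tact \<pi> p = (\<Sum>m\<in>Poly_Mapping.keys p. ?c m * (\<Prod>a\<in>{1..n}. tvar (\<pi> a) ^ Poly_Mapping.lookup m a))"
      by (subst p) (simp only: tact_sum[OF b] tact_mult[OF b] tact_prod[OF b] tact_power[OF b] tact_tvar[OF b] tact_const[OF b])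
  qed
  also have "\<dots> = (\<Sum>m\<in>Poly_Mapping.keys p. ?c m * injsum n {1..n} (Poly_Mapping.lookup m))"
    by (subst sum.swap) (simp only: injsum_eq_permutations sum_distrib_left)
  finally show ?thesis .
qed

text \<open>Each monomial of \<open>p\<close> has a variable with positive exponent, so all orbit
  sums in the expansion of \<open>n! p\<close> lie in the ideal. The division by \<open>n!\<close>
  takes place here.\<close>

lemma Epoly_if_zero_const:
  fixes p :: "'k::field tpoly"
  assumes "of_nat (fact n) \<noteq> (0::'k)" "p \<in> sym_polys n" "0 \<notin> Poly_Mapping.keys p"
  shows "p \<in> Epoly n"
proof -
  have "Poly_Mapping.single 0 (Poly_Mapping.lookup p m) * injsum n {1..n} (Poly_Mapping.lookup m) \<in> (Epoly n :: 'k tpoly set)"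
    if m: "m \<in> Poly_Mapping.keys p" for m
  proof -
    have "m \<noteq> 0" "Poly_Mapping.keys m \<subseteq> {1..n}" using assms m by (auto simp: sym_polys_def)
    then obtain a where "a \<in> {1..n}" "Poly_Mapping.lookup m a \<noteq> 0"
      by (metis all_not_in_conv in_keys_iff keys_eq_empty subsetD)
    then have "(injsum n {1..n} (Poly_Mapping.lookup m) :: 'k tpoly) \<in> Epoly n"
      by (intro injsum_in_Epoly[of _ a]) auto
    then show ?thesis by (intro Epoly_mult sym_polys_const)
  qed
  then have "of_nat (fact n) * p \<in> Epoly n"
    unfolding fact_mult_sym_poly[OF assms(2)] by (rule Epoly_sum)
  then have "Poly_Mapping.single 0 (inverse (of_nat (fact n))) * (of_nat (fact n) * p) \<in> Epoly n"
    by (rule Epoly_mult[OF _ sym_polys_const])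
  also have "Poly_Mapping.single 0 (inverse (of_nat (fact n))) * (of_nat (fact n) * p) = p"
  proof -
    have e: "(of_nat (fact n) :: 'k tpoly) = Poly_Mapping.single 0 (of_nat (fact n))"
      unfolding of_nat_single comp_apply ..
    show ?thesis
      unfolding e mult.assoc[symmetric] mult_single left_inverse[OF assms(1)] by simp
  qed
  finally show ?thesis .
qed

section \<open>Constant terms and residues\<close>

lemma zero_notin_keys_mult:
  assumes "0 \<notin> Poly_Mapping.keys (p :: 'k::comm_ring_1 tpoly)"
  shows "0 \<notin> Poly_Mapping.keys (q * p)"
proof
  assume "0 \<in> Poly_Mapping.keys (q * p)"
  then obtain a b where "0 = a + b" "b \<in> Poly_Mapping.keys p" using keys_mult[of q p] by auto
  then have "b = 0" by (intro poly_mapping_eqI) (metis add_is_0 lookup_add lookup_zero)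
  then show False using assms \<open>b \<in> _\<close> by simp
qed

lemma zero_notin_keys_add:
  assumes "0 \<notin> Poly_Mapping.keys (p :: 'k::comm_ring_1 tpoly)" "0 \<notin> Poly_Mapping.keys q"
  shows "0 \<notin> Poly_Mapping.keys (p + q)"
  using assms by (simp add: in_keys_iff lookup_add)

text \<open>The symmetric polynomials without constant term form an ideal containing the generators.
  This gives uniqueness of residues.\<close>

lemma Epoly_zero_const:
  assumes "(p :: 'k::comm_ring_1 tpoly) \<in> Epoly n"
  shows "0 \<notin> Poly_Mapping.keys p"
proof -
  let ?I = "{p \<in> sym_polys n. 0 \<notin> Poly_Mapping.keys (p :: 'k tpoly)}"
  have "ideal ?I (Lam n :: 'k tpoly ring)"
    by (rule Lam_idealI) (auto simp: sym_polys_add sym_polys_mult zero_notin_keys_add zero_notin_keys_mult)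
  moreover have "esym n ` {1..n} \<subseteq> ?I"
  proof safe
    fix l assume l: "l \<in> {1..n}" "0 \<in> Poly_Mapping.keys (esym n l :: 'k tpoly)"
    have "0 \<notin> Poly_Mapping.keys (\<Prod>i\<in>S. tvar i :: 'k tpoly)" if S: "S \<subseteq> {1..n}" "card S = l" for S
    proof -
      obtain i where i: "i \<in> S" using S l by fastforce
      have "finite S" using S finite_subset by blast
      then have "(\<Prod>i\<in>S. tvar i :: 'k tpoly) = (\<Prod>i\<in>S - {i}. tvar i) * tvar i"
        using i by (simp add: prod.remove mult.commute)
      moreover have "0 \<notin> Poly_Mapping.keys (tvar i :: 'k tpoly)" 
        by (auto simp: tvar_def dest!: arg_cong[where f = "\<lambda>m. Poly_Mapping.lookup m i"])
      ultimately show ?thesis using zero_notin_keys_mult by simp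
    qed
    then have "Poly_Mapping.lookup (esym n l :: 'k tpoly) 0 = 0"
      unfolding esym_def lookup_sum by (intro sum.neutral) (auto simp: in_keys_iff)
    then show False using l by (simp add: in_keys_iff)
  qed (rule esym_sym)
  ultimately have "Epoly n \<subseteq> ?I"
    unfolding Epoly_def by (rule ring.genideal_minimal[OF cring.axioms(1)[OF cring_Lam]])
  then show ?thesis using assms by blast
qed

text \<open>The scalar described by \<open>red\<close> is the constant coefficient: subtracting it
  leaves no constant term, and two admissible scalars have the same constant term as
  \<open>p\<close>.\<close>

lemma red_residue:
  fixes p :: "'k::field tpoly"
  assumes "of_nat (fact n) \<noteq> (0::'k)" "p \<in> sym_polys n"
  shows "p - tconst (red n p) \<in> Epoly n"
proof -
  let ?c = "Poly_Mapping.lookup p 0"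
  have ex: "p - tconst ?c \<in> Epoly n"
    using assms by (intro Epoly_if_zero_const)
      (auto simp: tconst_def sym_polys_diff sym_polys_const in_keys_iff lookup_minus)
  have "red n p = ?c"
    unfolding red_def Epoly_def[symmetric]
  proof (rule the_equality)
    show "p - tconst ?c \<in> Epoly n" by (rule ex)
  next
    fix d assume "p - tconst d \<in> Epoly n"
    then show "d = ?c" using Epoly_zero_const[of "p - tconst d" n]
      by (simp add: tconst_def in_keys_iff lookup_minus)
  qed
  then show ?thesis using ex by simp
qed

lemma of_nat_fact_neq_0:
  assumes "CHAR('k::field) = 0 \<or> coprime CHAR('k) (fact n)"
  shows "of_nat (fact n) \<noteq> (0::'k)"
proof
  assume "of_nat (fact n) = (0::'k)"
  then have "CHAR('k) dvd fact n" using of_nat_eq_0_iff_char_dvd[of "fact n", where 'a = 'k] by blast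
  moreover have "CHAR('k) \<noteq> 1" by simp
  ultimately show False using assms by (auto simp: coprime_absorb_left)
qed

section \<open>The matrices \<open>V\<close> and \<open>A\<^sub>l\<close>\<close>

lemma Vmat_carrier: "Vmat n \<in> carrier_mat n n"
  by (simp add: Vmat_def)

lemma det_permute_columns:
  assumes A: "(A :: 'a::comm_ring_1 mat) \<in> carrier_mat n n" and p: "p permutes {0..<n}"
  shows "det (mat n n (\<lambda>(i, j). A $$ (i, p j))) = signof p * det A"
proof -
  have lt: "p j < n" if "j < n" for j using permutes_in_image[OF p, of j] that by simp
  have "det (mat n n (\<lambda>(i, j). A $$ (i, p j))) = det (transpose_mat (mat n n (\<lambda>(i, j). A $$ (i, p j))))"
    by (rule det_transpose[symmetric, of _ n]) simp
  also have "transpose_mat (mat n n (\<lambda>(i, j). A $$ (i, p j))) = mat n n (\<lambda>(i, j). transpose_mat A $$ (p i, j))"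
    by (rule eq_matI) (use A lt in auto)
  also have "det \<dots> = signof p * det (transpose_mat A)"
    by (rule det_permute_rows) (use A p in auto)
  finally show ?thesis using det_transpose[OF A] by simp
qed

text \<open>Over a domain \<open>A\<close> may fail to be invertible, but multiplying by its
  adjugate leaves the nonzero scalar \<open>det A\<close>, which cancels entrywise.\<close>

lemma mult_mat_cancel_left:
  fixes A :: "'a::idom mat"
  assumes A: "A \<in> carrier_mat n n" and X: "X \<in> carrier_mat n n" and Y: "Y \<in> carrier_mat n n"
    and d: "det A \<noteq> 0" and eq: "A * X = A * Y"
  shows "X = Y"
proof -
  have *: "adj_mat A * (A * Z) = det A \<cdot>\<^sub>m Z" if Z: "Z \<in> carrier_mat n n" for Z
  proof -
    have "adj_mat A * (A * Z) = (adj_mat A * A) * Z"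
      using assoc_mult_mat[OF adj_mat(1)[OF A] A Z] by simp
    also have "\<dots> = det A \<cdot>\<^sub>m (1\<^sub>m n * Z)"
      unfolding adj_mat(3)[OF A] using mult_smult_assoc_mat[OF one_carrier_mat Z] by simp
    finally show ?thesis using Z by simp
  qed
  have sm: "det A \<cdot>\<^sub>m X = det A \<cdot>\<^sub>m Y" using *[OF X] *[OF Y] eq by simp
  show ?thesis
  proof (rule eq_matI)
    fix i j assume "i < dim_row Y" "j < dim_col Y"
    then show "X $$ (i, j) = Y $$ (i, j)"
      using arg_cong[OF sm, of "\<lambda>Z. Z $$ (i, j)"] X Y d by simp
  qed (use X Y in auto)
qed

text \<open>Translates a permutation of the variable indices, counted from 1, into one of the column
  positions, counted from 0.\<close>

definition shift_perm :: "(nat \<Rightarrow> nat) \<Rightarrow> nat \<Rightarrow> nat" where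
  "shift_perm \<pi> j = \<pi> (Suc j) - 1"

lemma shift_perm:
  assumes "\<pi> permutes {1..n}"
  shows "shift_perm \<pi> permutes {0..<n}" "j < n \<Longrightarrow> Suc (shift_perm \<pi> j) = \<pi> (Suc j)"
proof -
  have \<pi>: "1 \<le> \<pi> (Suc j) \<and> \<pi> (Suc j) \<le> n" if "j < n" for j
    using permutes_in_image[OF assms, of "Suc j"] that by simp
  show *: "Suc (shift_perm \<pi> j) = \<pi> (Suc j)" if "j < n" for j
    using \<pi>[OF that] by (simp add: shift_perm_def)
  have "inj_on (shift_perm \<pi>) {0..<n}"
  proof (rule inj_onI)
    fix i j assume "i \<in> {0..<n}" "j \<in> {0..<n}" "shift_perm \<pi> i = shift_perm \<pi> j"
    then have "\<pi> (Suc i) = \<pi> (Suc j)" using *[of i] *[of j] by simp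
    then show "i = j" using permutes_inj[OF assms] by (simp add: inj_eq)
  qed
  moreover have "shift_perm \<pi> ` {0..<n} \<subseteq> {0..<n}"
    using * \<pi> by (force simp: shift_perm_def)
  ultimately have "bij_betw (shift_perm \<pi>) {0..<n} {0..<n}"
    by (simp add: bij_betw_def endo_inj_surj)
  then show "shift_perm \<pi> permutes {0..<n}"
  proof (rule bij_imp_permutes)
    fix j assume "j \<notin> {0..<n}"
    then have "\<pi> (Suc j) = Suc j" using assms by (auto simp: permutes_def)
    then show "shift_perm \<pi> j = j" by (simp add: shift_perm_def)
  qed
qed

text \<open>Each column of \<open>V\<close> consists of powers of a single variable, so renaming
  variables moves whole columns.\<close>

lemma map_tact_Vmat:
  assumes "\<pi> permutes {1..n}"
  shows "map_mat (tact \<pi>) (Vmat n) = mat n n (\<lambda>(i, j). Vmat n $$ (i, shift_perm \<pi> j))"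
proof (rule eq_matI)
  fix i j assume "i < dim_row (mat n n (\<lambda>(i, j). Vmat n $$ (i, shift_perm \<pi> j)))"
    "j < dim_col (mat n n (\<lambda>(i, j). Vmat n $$ (i, shift_perm \<pi> j)))"
  then have ij: "i < n" "j < n" by auto
  have b: "bij \<pi>" using assms by (rule permutes_bij)
  have "shift_perm \<pi> j < n"
    using permutes_in_image[OF shift_perm(1)[OF assms], of j] ij by simp
  then show "map_mat (tact \<pi>) (Vmat n) $$ (i, j) = mat n n (\<lambda>(i, j). Vmat n $$ (i, shift_perm \<pi> j)) $$ (i, j)"
    using ij by (simp add: Vmat_def tact_power[OF b] tact_tvar[OF b] shift_perm(2)[OF assms])
qed (simp_all add: Vmat_def)

lemma det_map_tact_Vmat:
  assumes "\<pi> permutes {1..n}"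
  shows "det (map_mat (tact \<pi>) (Vmat n)) = signof (shift_perm \<pi>) * Delta n"
  unfolding map_tact_Vmat[OF assms] Delta_def
  by (rule det_permute_columns[OF Vmat_carrier shift_perm(1)[OF assms]])

lemma tact_Delta:
  assumes "\<pi> permutes {1..n}"
  shows "tact \<pi> (Delta n) = signof (shift_perm \<pi>) * Delta n"
proof -
  interpret comm_ring_hom "tact \<pi>" using permutes_bij[OF assms] by (rule comm_ring_hom_tact)
  show ?thesis using det_map_tact_Vmat[OF assms] by (simp add: Delta_def)
qed

lemma signof_square: "signof p * signof p = (1 :: 'a::comm_ring_1)"
  by (simp add: sign_def)

lemma Delta_tpolys: "Delta n \<in> tpolys n"
  unfolding Delta_def by (intro tpolys_det) (auto simp: Vmat_def intro!: tpolys_power tpolys_tvar)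

lemma Delta_square_sym: "Delta n ^ 2 \<in> sym_polys n"
  unfolding sym_polys_iff
proof (intro conjI allI impI tpolys_power Delta_tpolys)
  fix \<pi> assume pi: "\<pi> permutes {1..n}"
  have "tact \<pi> (Delta n ^ 2 :: 'a tpoly) = (signof (shift_perm \<pi>) * signof (shift_perm \<pi>)) * (Delta n * Delta n)"
    by (simp only: power2_eq_square tact_mult[OF permutes_bij[OF pi]] tact_Delta[OF pi] mult_ac)
  then show "tact \<pi> (Delta n ^ 2) = (Delta n ^ 2 :: 'a tpoly)"
    by (simp only: signof_square power2_eq_square mult_1)
qed

text \<open>In the Leibniz expansion the diagonal monomial, with exponent \<open>i\<close> at
  variable \<open>i + 1\<close>, comes from the identity alone; its coefficient is therefore
  1.\<close>

lemma Delta_neq_0: "Delta n \<noteq> (0 :: 'k::idom tpoly)"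
proof -
  define m where "m = (\<Sum>i = 0..<n. Poly_Mapping.single (Suc i) i)"
  \<comment> \<open>In the monomial of \<open>p\<close>, the variable \<open>p j + 1\<close> has
    exponent \<open>j\<close>, so the monomial determines \<open>p\<close>.\<close>
  have lm: "Poly_Mapping.lookup (\<Sum>i = 0..<n. Poly_Mapping.single (Suc (p i)) i) (Suc (p j)) = j"
    if p: "p permutes {0..<n}" "j < n" for p :: "nat \<Rightarrow> nat" and j
  proof -
    have "Poly_Mapping.lookup (\<Sum>i = 0..<n. Poly_Mapping.single (Suc (p i)) i) (Suc (p j)) =
        (\<Sum>i = 0..<n. if i = j then i else 0)"
      unfolding lookup_sum by (rule sum.cong) (use permutes_inj[OF p(1)] in \<open>auto simp: lookup_single when_def inj_eq\<close>)
    also have "\<dots> = j" using p(2) by simp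
    finally show ?thesis .
  qed
  have eq: "(\<Sum>i = 0..<n. Poly_Mapping.single (Suc (p i)) i) = m \<longleftrightarrow> p = id" if p: "p permutes {0..<n}" for p
  proof
    assume h: "(\<Sum>i = 0..<n. Poly_Mapping.single (Suc (p i)) i) = m"
    have "p j = j" for j
    proof (cases "j < n")
      case True
      then have "p j < n" using permutes_in_image[OF p, of j] by simp
      from lm[OF permutes_id this] show ?thesis using lm[OF p True] unfolding h m_def by simp
    qed (use p in \<open>auto simp: permutes_def\<close>)
    then show "p = id" by auto
  qed (simp add: m_def)
  have "(\<Prod>i = 0..<n. Vmat n $$ (i, p i)) = (Poly_Mapping.single (\<Sum>i = 0..<n. Poly_Mapping.single (Suc (p i)) i) 1 :: 'k tpoly)"
    if p: "p permutes {0..<n}" for p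
  proof -
    have "(\<Prod>i = 0..<n. Vmat n $$ (i, p i)) = (\<Prod>i = 0..<n. Poly_Mapping.single (Poly_Mapping.single (Suc (p i)) i) (1::'k))"
    proof (rule prod.cong[OF refl])
      fix i assume "i \<in> {0..<n}"
      then show "Vmat n $$ (i, p i) = Poly_Mapping.single (Poly_Mapping.single (Suc (p i)) i) (1::'k)"
        using permutes_in_image[OF p, of i] by (simp add: Vmat_def tvar_power)
    qed
    then show ?thesis by (simp add: prod_single)
  qed
  then have "Poly_Mapping.lookup (signof p * (\<Prod>i = 0..<n. Vmat n $$ (i, p i)) :: 'k tpoly) m = (if p = id then 1 else 0)"
    if "p permutes {0..<n}" for p
    using that eq[OF that] by (auto simp: sign_def lookup_single when_def)
  then have "Poly_Mapping.lookup (Delta n :: 'k tpoly) m = (\<Sum>p | p permutes {0..<n}. if p = id then 1 else 0)"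
    unfolding Delta_def det_def'[OF Vmat_carrier] lookup_sum by (intro sum.cong) auto
  also have "\<dots> = 1"
    by (simp add: finite_permutations permutes_id)
  finally show ?thesis by auto
qed

text \<open>Both sides are entries of matrices whose product with the permuted \<open>V\<close> is
  its determinant times the identity. Cancelling the permuted \<open>V\<close> identifies them
  without computing with cofactors.\<close>

lemma tact_adj_Vmat:
  assumes pi: "\<pi> permutes {1..n}" and jk: "j < n" "k < n"
  shows "tact \<pi> (adj_mat (Vmat n) $$ (j, k)) =
    (signof (shift_perm \<pi>) * adj_mat (Vmat n) $$ (shift_perm \<pi> j, k) :: 'k::idom tpoly)"
proof -
  interpret comm_ring_hom "tact \<pi> :: 'k tpoly \<Rightarrow> _" using permutes_bij[OF pi] by (rule comm_ring_hom_tact)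
  let ?V = "Vmat n :: 'k tpoly mat" and ?B = "adj_mat (Vmat n) :: 'k tpoly mat"
  let ?s = "signof (shift_perm \<pi>) :: 'k tpoly"
  let ?V' = "map_mat (tact \<pi>) ?V" and ?B' = "map_mat (tact \<pi>) ?B"
  \<comment> \<open>Permuting the rows of the adjugate compensates the permuted columns of
    \<open>V\<close>; the sign turns the resulting scalar \<open>Delta n\<close> into the
    determinant of \<open>?V'\<close>.\<close>
  let ?C = "mat n n (\<lambda>(j, k). ?s * ?B $$ (shift_perm \<pi> j, k))"
  have B: "?B \<in> carrier_mat n n" using adj_mat(1)[OF Vmat_carrier] .
  have sp: "shift_perm \<pi> permutes {0..<n}" using shift_perm(1)[OF pi] .
  have lt: "shift_perm \<pi> j < n" if "j < n" for j using permutes_in_image[OF sp, of j] that by simp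
  have "?V' * ?B' = map_mat (tact \<pi>) (?V * ?B)"
    by (rule mat_hom_mult[symmetric]) (use Vmat_carrier B in auto)
  also have "\<dots> = (?s * Delta n) \<cdot>\<^sub>m 1\<^sub>m n"
    unfolding adj_mat(2)[OF Vmat_carrier] using tact_Delta[OF pi, where 'a = 'k]
    by (intro eq_matI) (auto simp: Delta_def)
  also have "\<dots> = ?V' * ?C"
  proof (rule eq_matI)
    fix i k assume "i < dim_row (?V' * ?C)" "k < dim_col (?V' * ?C)"
    then have ik: "i < n" "k < n" by (auto simp: Vmat_def)
    have "(?V' * ?C) $$ (i, k) = (\<Sum>j = 0..<n. ?V $$ (i, shift_perm \<pi> j) * (?s * ?B $$ (shift_perm \<pi> j, k)))"
      unfolding map_tact_Vmat[OF pi] using ik by (simp add: scalar_prod_def)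
    also have "\<dots> = ?s * (\<Sum>j = 0..<n. ?V $$ (i, shift_perm \<pi> j) * ?B $$ (shift_perm \<pi> j, k))"
      by (simp add: sum_distrib_left mult_ac)
    also have "(\<Sum>j = 0..<n. ?V $$ (i, shift_perm \<pi> j) * ?B $$ (shift_perm \<pi> j, k)) = (\<Sum>j = 0..<n. ?V $$ (i, j) * ?B $$ (j, k))"
      using sum.permute[OF sp, of "\<lambda>j. ?V $$ (i, j) * ?B $$ (j, k)"] by (simp only: comp_def)
    also have "\<dots> = (?V * ?B) $$ (i, k)"
      using ik B Vmat_carrier[where 'a = 'k and n = n] by (simp add: scalar_prod_def)
    finally show "((?s * Delta n) \<cdot>\<^sub>m 1\<^sub>m n) $$ (i, k) = (?V' * ?C) $$ (i, k)"
      unfolding adj_mat(2)[OF Vmat_carrier] using ik by (simp add: Delta_def)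
  qed (auto simp: Vmat_def)
  finally have "?V' * ?B' = ?V' * ?C" .
  moreover have "det ?V' \<noteq> 0"
    unfolding det_map_tact_Vmat[OF pi] using Delta_neq_0[of n, where 'k = 'k] by (simp add: sign_def)
  ultimately have "?B' = ?C"
    using B Vmat_carrier[where 'a = 'k and n = n] mult_mat_cancel_left[of ?V' n ?B' ?C]
    by (simp only: map_carrier_mat mat_carrier simp_thms)
  then have "?B' $$ (j, k) = ?C $$ (j, k)" by simp
  then show ?thesis using jk B by simp
qed

lemma mat_diag_pow: "mat_diag n f ^\<^sub>m k = mat_diag n (\<lambda>i. f i ^ k)"
proof (induction k)
  case 0
  show ?case by (rule eq_matI) (auto simp: mat_diag_def)
next
  case (Suc k)
  then show ?case by (simp add: mat_diag_diag power_commutes)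
qed

lemma Amat_index:
  assumes "i < n" "j < n"
  shows "(Amat n l $$ (i, j) :: 'k::comm_ring_1 tpoly) =
    (\<Sum>k = 0..<n. adj_mat (Vmat n) $$ (k, i) * tvar (Suc k) ^ (l - 1) * adj_mat (Vmat n) $$ (k, j))"
proof -
  let ?B = "adj_mat (Vmat n) :: 'k tpoly mat"
  have B: "?B \<in> carrier_mat n n" using adj_mat(1)[OF Vmat_carrier] .
  have "transpose_mat ?B * mat_diag n (\<lambda>i. tvar (i + 1) ^ (l - 1)) =
      mat n n (\<lambda>(i, k). transpose_mat ?B $$ (i, k) * tvar (k + 1) ^ (l - 1))"
    by (rule mat_diag_mult_right) (use B in auto)
  then show ?thesis
    unfolding Amat_def mat_diag_pow using assms B by (simp add: scalar_prod_def)
qed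

text \<open>In the sum over \<open>k\<close> the two adjugate entries contribute the same sign
  twice, while their row index moves together with the variable of index \<open>k + 1\<close>; only
  the order of summation changes. The entries are polynomials in the right variables because they
  are built from minors of \<open>V\<close>.\<close>

lemma Amat_sym:
  assumes ij: "i < n" "j < n"
  shows "(Amat n l $$ (i, j) :: 'k::idom tpoly) \<in> sym_polys n"
  unfolding sym_polys_iff
proof (intro conjI allI impI)
  have "(adj_mat (Vmat n) $$ (i, j) :: 'k tpoly) \<in> tpolys n" if "i < n" "j < n" for i j
  proof -
    have "det (mat_delete (Vmat n) j i) \<in> (tpolys n :: 'k tpoly set)"
      by (rule tpolys_det) (auto simp: mat_delete_def Vmat_def intro!: tpolys_mult tpolys_power tpolys_tvar)
    then have "(-1) ^ (j + i) * det (mat_delete (Vmat n) j i) \<in> (tpolys n :: 'k tpoly set)"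
      by (intro tpolys_mult tpolys_power tpolys_uminus tpolys_0_1)
    then show ?thesis using that by (simp add: adj_mat_def cofactor_def Vmat_def)
  qed
  then show "(Amat n l $$ (i, j) :: 'k tpoly) \<in> tpolys n"
    unfolding Amat_index[OF ij] using ij by (intro tpolys_sum tpolys_mult tpolys_power tpolys_tvar) auto
next
  fix \<pi> assume pi: "\<pi> permutes {1..n}"
  have b: "bij \<pi>" using permutes_bij[OF pi] .
  let ?s = "signof (shift_perm \<pi>) :: 'k tpoly"
  let ?B = "adj_mat (Vmat n) :: 'k tpoly mat"
  let ?F = "\<lambda>k. ?B $$ (k, i) * tvar (Suc k) ^ (l - 1) * ?B $$ (k, j)"
  have sp: "shift_perm \<pi> permutes {0..<n}" using shift_perm(1)[OF pi] .
  have "tact \<pi> (Amat n l $$ (i, j) :: 'k tpoly) = (\<Sum>k = 0..<n. tact \<pi> (?F k))"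
    unfolding Amat_index[OF ij] tact_sum[OF b] ..
  also have "\<dots> = (\<Sum>k = 0..<n. ?F (shift_perm \<pi> k))"
  proof (rule sum.cong[OF refl])
    fix k assume "k \<in> {0..<n}"
    then have k: "k < n" by simp
    have "tact \<pi> (?F k) = (?s * ?s) * ?F (shift_perm \<pi> k)"
      by (simp only: tact_mult[OF b] tact_power[OF b] tact_tvar[OF b] tact_adj_Vmat[OF pi k ij(1)]
        tact_adj_Vmat[OF pi k ij(2)] shift_perm(2)[OF pi k] mult_ac)
    then show "tact \<pi> (?F k) = ?F (shift_perm \<pi> k)" by (simp only: signof_square mult_1)
  qed
  also have "\<dots> = (\<Sum>k = 0..<n. ?F k)"
    using sum.permute[OF sp, of ?F] by (simp only: comp_def)
  finally show "tact \<pi> (Amat n l $$ (i, j)) = (Amat n l $$ (i, j) :: 'k tpoly)"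
    unfolding Amat_index[OF ij] .
qed

section \<open>The ideal \<open>J'\<close>\<close>

lemma mono_sign_neutral [simp]:
  "mono_sign ({}, {}, w) M = 1" "mono_sign M ({}, {}, w) = 1"
  by (cases M; simp add: inversions_def)+

lemma mono_mult_neutral [simp]: "mono_mult ({}, {}, 0) M = M" "mono_mult M ({}, {}, 0) = M"
  by (cases M; simp)+

lemma lookup_sconst_mult [simp]:
  "Poly_Mapping.lookup (sconst p \<star> f) M = p * Poly_Mapping.lookup f M"
proof -
  have "sconst p \<star> f = sconst p \<star> (\<Sum>N\<in>Poly_Mapping.keys f. Poly_Mapping.single N (Poly_Mapping.lookup f N))"
    by (simp only: salg_expand[symmetric])
  also have "\<dots> = (\<Sum>N\<in>Poly_Mapping.keys f. Poly_Mapping.single N (p * Poly_Mapping.lookup f N))"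
    by (simp add: sconst_def salg_mult_sum_right salg_mult_single)
  finally show ?thesis
    by (auto simp: lookup_sum lookup_single when_def in_keys_iff)
qed

lemma mult_sconst_commute: "f \<star> sconst p = sconst p \<star> f"
proof -
  have "(\<Sum>N\<in>A. Poly_Mapping.single N (F N)) \<star> sconst p = sconst p \<star> (\<Sum>N\<in>A. Poly_Mapping.single N (F N))" for A F
    by (simp add: sconst_def salg_mult_sum_right salg_mult_sum_left salg_mult_single mult.commute)
  from this[of "Poly_Mapping.lookup f" "Poly_Mapping.keys f"] show ?thesis
    unfolding salg_expand[of f, symmetric] .
qed

lemma sconst_mult_sconst: "sconst p \<star> (sconst q \<star> f) = sconst (p * q) \<star> f"
  by (rule poly_mapping_eqI) (simp add: mult.assoc)

lemma sconst_mult_single: "sconst p \<star> Poly_Mapping.single M q = Poly_Mapping.single M (p * q)"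
  by (simp add: sconst_def salg_mult_single)

lemma single_eq_sconst_mult: "Poly_Mapping.single M p = sconst p \<star> smono M"
  by (simp add: smono_def sconst_mult_single)

lemma sconst_carrier: "p \<in> sym_polys n \<Longrightarrow> sconst p \<in> salg_carrier n"
  unfolding sconst_def by (rule salg_carrier_single) (simp_all add: mono_set_def)

lemma smono_carrier: "M \<in> mono_set n \<Longrightarrow> smono M \<in> salg_carrier n"
  unfolding smono_def by (rule salg_carrier_single) simp_all

lemma carrier_mult_assoc:
  "f \<in> salg_carrier n \<Longrightarrow> g \<in> salg_carrier n \<Longrightarrow> h \<in> salg_carrier n \<Longrightarrow> (f \<star> g) \<star> h = f \<star> (g \<star> h)"
  by (rule salg_mult_assoc[of _ n]) (simp_all add: salg_carrier_iff)

lemma sconst_keys: "Poly_Mapping.keys (sconst p) \<subseteq> mono_set n"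
  by (auto simp: sconst_def mono_set_def split: if_splits)

lemma sconst_mult_left_commute:
  assumes "f \<in> salg_carrier n" "g \<in> salg_carrier n"
  shows "sconst p \<star> (f \<star> g) = f \<star> (sconst p \<star> g)"
proof -
  have k: "Poly_Mapping.keys f \<subseteq> mono_set n" "Poly_Mapping.keys g \<subseteq> mono_set n"
    using assms by (simp_all add: salg_carrier_iff)
  have "sconst p \<star> (f \<star> g) = (f \<star> sconst p) \<star> g"
    by (simp only: salg_mult_assoc[OF sconst_keys k, symmetric] mult_sconst_commute)
  then show ?thesis by (simp only: salg_mult_assoc[OF k(1) sconst_keys k(2)])
qed

text \<open>The products \<open>X_i Y_j\<close> are already in standard order, so the bilinear term
  expands without signs.\<close>

lemma Rel_eq: "Rel n l = Poly_Mapping.single ({}, {}, Poly_Mapping.single l 1) (Delta n ^ 2) -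
    (\<Sum>i\<in>{1..n}. \<Sum>j\<in>{1..n}. Poly_Mapping.single ({i}, {j}, 0) (Amat n l $$ (i - 1, j - 1)))"
proof -
  have "sconst p \<star> Wg l = Poly_Mapping.single ({}, {}, Poly_Mapping.single l 1) p" for p :: "'a tpoly"
    by (simp add: Wg_def single_eq_sconst_mult)
  moreover have "Xg i \<star> sconst p \<star> Yg j = Poly_Mapping.single ({i}, {j}, 0) p" for i j and p :: "'a tpoly"
    by (simp add: Xg_def Yg_def sconst_def smono_def salg_mult_single inversions_def)
  ultimately show ?thesis by (simp add: Rel_def)
qed

lemma Rel_keys:
  assumes "N \<in> Poly_Mapping.keys (Rel n l :: 'k::comm_ring_1 salg)"
  shows "N = ({}, {}, Poly_Mapping.single l 1) \<or> (\<exists>i\<in>{1..n}. \<exists>j\<in>{1..n}. N = ({i}, {j}, 0))"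
proof (rule ccontr)
  assume "\<not> ?thesis"
  then have "N \<noteq> ({}, {}, Poly_Mapping.single l 1)" "\<forall>i\<in>{1..n}. \<forall>j\<in>{1..n}. ({i}, {j}, 0) \<noteq> N"
    by blast+
  then have "Poly_Mapping.lookup (Rel n l :: 'k salg) N = 0"
    by (simp add: Rel_eq lookup_minus lookup_sum lookup_single)
  then show False using assms by (simp add: in_keys_iff)
qed

lemma Rel_carrier:
  assumes "l \<in> {1..<n}"
  shows "(Rel n l :: 'k::idom salg) \<in> salg_carrier n"
proof -
  have "(Poly_Mapping.single ({}, {}, Poly_Mapping.single l 1) (Delta n ^ 2) :: 'k salg) \<in> salg_carrier n"
    using assms by (intro salg_carrier_single Delta_square_sym) (auto simp: mono_set_def)
  moreover have "(\<Sum>i\<in>{1..n}. \<Sum>j\<in>{1..n}. Poly_Mapping.single ({i}, {j}, 0) (Amat n l $$ (i - 1, j - 1)) :: 'k salg) \<in> salg_carrier n"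
    by (intro salg_carrier_sum salg_carrier_single Amat_sym) (auto simp: mono_set_def)
  ultimately show ?thesis
    unfolding Rel_eq diff_conv_add_uminus by (intro salg_carrier_add salg_carrier_uminus)
qed

text \<open>Each element of \<open>S\<close> lies either below or above \<open>i\<close> and is
  counted in exactly one of the two summands.\<close>

lemma inversions_singleton_add:
  assumes "finite S" "i \<notin> S"
  shows "inversions {i} S + inversions S {i} = card S"
proof -
  have "{(a, b). a \<in> {i} \<and> b \<in> S \<and> b < a} = Pair i ` {s \<in> S. s < i}"
    "{(a, b). a \<in> S \<and> b \<in> {i} \<and> b < a} = (\<lambda>s. (s, i)) ` {s \<in> S. i < s}" by auto
  then have "inversions {i} S = card {s \<in> S. s < i}" "inversions S {i} = card {s \<in> S. i < s}"
    by (simp_all add: inversions_def card_image inj_on_def)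
  moreover have "card {s \<in> S. s < i} + card {s \<in> S. i < s} = card ({s \<in> S. s < i} \<union> {s \<in> S. i < s})"
    using assms by (intro card_Un_disjoint[symmetric]) auto
  moreover have "{s \<in> S. s < i} \<union> {s \<in> S. i < s} = S"
    using assms(2) by (auto dest: neq_iff[THEN iffD1] intro: linorder_neqE_nat)
  ultimately show ?thesis by simp
qed

text \<open>The monomials of a relation are even. For \<open>X_i Y_j\<close> against
  \<open>X_S Y_T\<close>, the sign exponents of the two orders add up to
  \<open>2 * card S + 2 * card T\<close>, so they have the same parity; if a generator repeats, both
  signs are 0.\<close>

lemma Rel_keys_commute:
  assumes "M \<in> Poly_Mapping.keys (Rel n l :: 'k::comm_ring_1 salg)" "N \<in> mono_set n"
  shows "mono_sign M N = mono_sign N M" "mono_mult M N = mono_mult N M"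
proof -
  obtain S T w where N: "N = (S, T, w)" by (cases N)
  have fin: "finite S" "finite T" using assms(2) finite_subset[of _ "{1..n}"] by (auto simp: N mono_set_def)
  show "mono_mult M N = mono_mult N M" by (cases M) (auto simp: N add.commute)
  show "mono_sign M N = mono_sign N M"
  proof (cases "M = ({}, {}, Poly_Mapping.single l 1)")
    case False
    then obtain i j where M: "M = ({i}, {j}, 0)" using Rel_keys[OF assms(1)] by blast
    show ?thesis
    proof (cases "i \<in> S \<or> j \<in> T")
      case False
      then have "inversions {i} S + inversions S {i} = card S" "inversions {j} T + inversions T {j} = card T"
        using fin inversions_singleton_add by blast+
      then have "even ((inversions {i} S + card S + inversions {j} T) + (inversions S {i} + card T + inversions T {j}))"
        by presburger
      then have "even (inversions {i} S + card S + inversions {j} T) = even (inversions S {i} + card T + inversions T {j})"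
        by simp
      then show ?thesis using False by (simp add: M N minus_one_power_iff)
    qed (auto simp: M N)
  qed simp
qed

lemma Rel_commute:
  assumes "(f :: 'k::comm_ring_1 salg) \<in> salg_carrier n"
  shows "Rel n l \<star> f = f \<star> Rel n l"
proof -
  have keys: "Poly_Mapping.keys f \<subseteq> mono_set n" using assms by (simp add: salg_carrier_iff)
  have "Rel n l \<star> f = (\<Sum>M\<in>Poly_Mapping.keys (Rel n l :: 'k salg). \<Sum>N\<in>Poly_Mapping.keys f.
     Poly_Mapping.single (mono_mult N M) (mono_sign N M * Poly_Mapping.lookup f N * Poly_Mapping.lookup (Rel n l) M))"
    unfolding salg_mult_def
  proof (rule sum.cong[OF refl], rule sum.cong[OF refl])
    fix M N assume "M \<in> Poly_Mapping.keys (Rel n l :: 'k salg)" "N \<in> Poly_Mapping.keys f"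
    then have M: "M \<in> Poly_Mapping.keys (Rel n l :: 'k salg)" and N: "N \<in> mono_set n" using keys by auto
    show "Poly_Mapping.single (mono_mult M N) (mono_sign M N * Poly_Mapping.lookup (Rel n l) M * Poly_Mapping.lookup f N) =
        Poly_Mapping.single (mono_mult N M) (mono_sign N M * Poly_Mapping.lookup f N * Poly_Mapping.lookup (Rel n l) M)"
      unfolding Rel_keys_commute(1)[OF M N] Rel_keys_commute(2)[OF M N] by (simp only: mult_ac)
  qed
  also have "\<dots> = f \<star> Rel n l" unfolding salg_mult_def by (rule sum.swap)
  finally show ?thesis .
qed

section \<open>The ideal generated by the relations\<close>

lemma Aprime_idealI:
  fixes I :: "'k::comm_ring_1 salg set"
  assumes "I \<subseteq> salg_carrier n" "0 \<in> I" "\<And>a b. a \<in> I \<Longrightarrow> b \<in> I \<Longrightarrow> a + b \<in> I"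
    "\<And>a x. a \<in> I \<Longrightarrow> x \<in> salg_carrier n \<Longrightarrow> x \<star> a \<in> I"
    "\<And>a x. a \<in> I \<Longrightarrow> x \<in> salg_carrier n \<Longrightarrow> a \<star> x \<in> I"
  shows "ideal I (Aprime n)"
proof (rule idealI[OF ring_Aprime])
  have grp: "Group.group (add_monoid (Aprime n :: 'k salg ring))"
    using abelian_group.a_group[OF ring.axioms(1)[OF ring_Aprime]] .
  show "subgroup I (add_monoid (Aprime n))"
  proof (rule group.subgroupI[OF grp])
    fix a assume a: "a \<in> I"
    have "- a = sconst (-1) \<star> a" by (rule poly_mapping_eqI) simp
    moreover have "sconst (-1) \<star> a \<in> I"
      by (intro assms(4) a sconst_carrier sym_polys_uminus) simp
    ultimately have "- a \<in> I" by simp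
    moreover have "inv\<^bsub>add_monoid (Aprime n)\<^esub> a = - a"
      by (rule group.inv_equality[OF grp]) (use a \<open>- a \<in> I\<close> assms(1) in \<open>auto simp: Aprime_simps\<close>)
    ultimately show "inv\<^bsub>add_monoid (Aprime n)\<^esub> a \<in> I" by simp
  qed (use assms in \<open>auto simp: Aprime_simps\<close>)
qed (use assms in \<open>auto simp: Aprime_simps\<close>)

definition Rspan :: "nat \<Rightarrow> 'k::comm_ring_1 salg set" where
  "Rspan n = {\<Sum>l\<in>{1..<n}. c l \<star> Rel n l | c. \<forall>l\<in>{1..<n}. c l \<in> salg_carrier n}"

lemma RspanI: "(\<And>l. l \<in> {1..<n} \<Longrightarrow> c l \<in> salg_carrier n) \<Longrightarrow> (\<Sum>l\<in>{1..<n}. c l \<star> Rel n l) \<in> Rspan n"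
  unfolding Rspan_def by blast

lemma Rspan_carrier: "a \<in> Rspan n \<Longrightarrow> (a :: 'k::idom salg) \<in> salg_carrier n"
  unfolding Rspan_def by (auto intro!: salg_carrier_sum salg_carrier_mult Rel_carrier)

lemma Rspan_0: "0 \<in> Rspan n"
  using RspanI[of n "\<lambda>_. 0"] by (simp add: salg_carrier_0)

lemma Rspan_add: "a \<in> Rspan n \<Longrightarrow> b \<in> Rspan n \<Longrightarrow> a + b \<in> Rspan n"
proof -
  assume "a \<in> Rspan n" "b \<in> Rspan n"
  then obtain c d where "a = (\<Sum>l\<in>{1..<n}. c l \<star> Rel n l)" "b = (\<Sum>l\<in>{1..<n}. d l \<star> Rel n l)"
    "\<forall>l\<in>{1..<n}. c l \<in> salg_carrier n" "\<forall>l\<in>{1..<n}. d l \<in> salg_carrier n"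
    unfolding Rspan_def by blast
  then show ?thesis
    using RspanI[of n "\<lambda>l. c l + d l"] by (simp add: salg_mult_add_left sum.distrib salg_carrier_add)
qed

lemma Rspan_mult_left:
  assumes "(a :: 'k::idom salg) \<in> Rspan n" "x \<in> salg_carrier n"
  shows "x \<star> a \<in> Rspan n"
proof -
  obtain c where a: "a = (\<Sum>l\<in>{1..<n}. c l \<star> Rel n l)" and c: "\<forall>l\<in>{1..<n}. c l \<in> salg_carrier n"
    using assms unfolding Rspan_def by blast
  have "x \<star> a = (\<Sum>l\<in>{1..<n}. (x \<star> c l) \<star> Rel n l)"
    unfolding a salg_mult_sum_right
    by (intro sum.cong refl carrier_mult_assoc[where n = n, symmetric] assms Rel_carrier) (use c in auto)
  then show ?thesis
    using RspanI[of n "\<lambda>l. x \<star> c l"] c assms(2) by (simp add: salg_carrier_mult)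
qed

text \<open>Centrality moves \<open>x\<close> across the relation into the left coefficient.\<close>

lemma Rspan_mult_right:
  assumes "(a :: 'k::idom salg) \<in> Rspan n" "x \<in> salg_carrier n"
  shows "a \<star> x \<in> Rspan n"
proof -
  obtain c where a: "a = (\<Sum>l\<in>{1..<n}. c l \<star> Rel n l)" and c: "\<forall>l\<in>{1..<n}. c l \<in> salg_carrier n"
    using assms unfolding Rspan_def by blast
  have "a \<star> x = (\<Sum>l\<in>{1..<n}. (c l \<star> x) \<star> Rel n l)"
    unfolding a salg_mult_sum_left
  proof (rule sum.cong[OF refl])
    fix l assume l: "l \<in> {1..<n}"
    have "(c l \<star> Rel n l) \<star> x = c l \<star> (Rel n l \<star> x)"
      by (intro carrier_mult_assoc[where n = n] Rel_carrier l assms(2) bspec[OF c l])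
    also have "\<dots> = (c l \<star> x) \<star> Rel n l"
      unfolding Rel_commute[OF assms(2)] 
      by (intro carrier_mult_assoc[where n = n, symmetric] Rel_carrier l assms(2) bspec[OF c l])
    finally show "(c l \<star> Rel n l) \<star> x = (c l \<star> x) \<star> Rel n l" .
  qed
  then show ?thesis
    using RspanI[of n "\<lambda>l. c l \<star> x"] c assms(2) by (simp add: salg_carrier_mult)
qed

lemma Rel_in_Rspan:
  assumes "l \<in> {1..<n}"
  shows "(Rel n l :: 'k::idom salg) \<in> Rspan n"
proof -
  have "(\<Sum>l'\<in>{1..<n}. (if l' = l then sconst 1 else 0) \<star> Rel n l' :: 'k salg) =
      (\<Sum>l'\<in>{1..<n}. if l' = l then Rel n l' else 0)"
    by (intro sum.cong) (auto simp: salg_mult_one)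
  also have "\<dots> = Rel n l" using assms by simp
  finally show ?thesis
    using RspanI[of n "\<lambda>l'. if l' = l then sconst 1 else (0 :: 'k salg)"]
    by (simp add: sconst_carrier salg_carrier_0)
qed

text \<open>The relations are central, so the two-sided ideal they generate is their left span.\<close>

lemma genideal_Rel: "Idl\<^bsub>Aprime n\<^esub> (Rel n ` {1..<n}) = (Rspan n :: 'k::idom salg set)"
proof
  have "ideal (Rspan n :: 'k salg set) (Aprime n)"
    by (rule Aprime_idealI) (auto simp: Rspan_carrier Rspan_0 Rspan_add Rspan_mult_left Rspan_mult_right)
  then show "Idl\<^bsub>Aprime n\<^esub> (Rel n ` {1..<n}) \<subseteq> (Rspan n :: 'k salg set)"
    by (rule ring.genideal_minimal[OF ring_Aprime]) (use Rel_in_Rspan in blast)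
next
  have sub: "Rel n ` {1..<n} \<subseteq> carrier (Aprime n :: 'k salg ring)"
    by (auto simp: Aprime_simps intro: Rel_carrier)
  interpret I: ideal "Idl\<^bsub>Aprime n\<^esub> (Rel n ` {1..<n}) :: 'k salg set" "Aprime n"
    by (rule ring.genideal_ideal[OF ring_Aprime sub])
  have gen: "Rel n l \<in> Idl\<^bsub>Aprime n\<^esub> (Rel n ` {1..<n} :: 'k salg set)" if "l \<in> {1..<n}" for l
    using ring.genideal_self[OF ring_Aprime sub] that by blast
  have sum: "(\<Sum>l\<in>L. F l) \<in> Idl\<^bsub>Aprime n\<^esub> (Rel n ` {1..<n})"
    if "\<And>l. l \<in> L \<Longrightarrow> F l \<in> Idl\<^bsub>Aprime n\<^esub> (Rel n ` {1..<n})" for L and F :: "nat \<Rightarrow> 'k salg"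
    using that additive_subgroup.zero_closed[OF I.additive_subgroup_axioms]
      additive_subgroup.a_closed[OF I.additive_subgroup_axioms]
    by (induction L rule: infinite_finite_induct) (auto simp: Aprime_simps)
  show "(Rspan n :: 'k salg set) \<subseteq> Idl\<^bsub>Aprime n\<^esub> (Rel n ` {1..<n})"
  proof
    fix a :: "'k salg" assume "a \<in> Rspan n"
    then obtain c where a: "a = (\<Sum>l\<in>{1..<n}. c l \<star> Rel n l)" and c: "\<forall>l\<in>{1..<n}. c l \<in> salg_carrier n"
      unfolding Rspan_def by blast
    show "a \<in> Idl\<^bsub>Aprime n\<^esub> (Rel n ` {1..<n})"
      unfolding a using I.I_l_closed[OF gen] c by (intro sum) (auto simp: Aprime_simps)
  qed
qed

section \<open>The saturation\<close>

lemma Delta_even_power_sym: "Delta n ^ (2 * m) \<in> sym_polys n"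
  unfolding power_mult by (rule sym_polys_power[OF Delta_square_sym])

lemma Jprime_iff: "(a :: 'k::idom salg) \<in> Jprime n \<longleftrightarrow>
    a \<in> salg_carrier n \<and> (\<exists>m. sconst (Delta n ^ (2 * m)) \<star> a \<in> Rspan n)"
  unfolding Jprime_def genideal_Rel by (simp add: Aprime_simps)

text \<open>Lets two elements be tested with a common exponent, as sums require.\<close>

lemma Rspan_Delta_mono:
  assumes "sconst (Delta n ^ (2 * m)) \<star> a \<in> Rspan n" "m \<le> m'"
  shows "sconst (Delta n ^ (2 * m')) \<star> (a :: 'k::idom salg) \<in> Rspan n"
proof -
  have "sconst (Delta n ^ (2 * (m' - m))) \<star> (sconst (Delta n ^ (2 * m)) \<star> a) \<in> Rspan n"
    by (intro Rspan_mult_left assms sconst_carrier Delta_even_power_sym)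
  then show ?thesis using assms(2) by (simp add: sconst_mult_sconst power_add[symmetric] algebra_simps)
qed

lemma Jprime_0: "(0 :: 'k::idom salg) \<in> Jprime n"
  by (simp add: Jprime_iff salg_carrier_0 Rspan_0)

lemma Jprime_add:
  assumes "(a :: 'k::idom salg) \<in> Jprime n" "b \<in> Jprime n"
  shows "a + b \<in> Jprime n"
proof -
  obtain m m' where "sconst (Delta n ^ (2 * m)) \<star> a \<in> Rspan n" "sconst (Delta n ^ (2 * m')) \<star> b \<in> Rspan n"
    using assms by (auto simp: Jprime_iff)
  then have "sconst (Delta n ^ (2 * max m m')) \<star> a \<in> Rspan n" "sconst (Delta n ^ (2 * max m m')) \<star> b \<in> Rspan n"
    by (auto intro: Rspan_Delta_mono)
  then have "sconst (Delta n ^ (2 * max m m')) \<star> (a + b) \<in> Rspan n"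
    unfolding salg_mult_add_right by (rule Rspan_add)
  then show ?thesis using assms by (auto simp: Jprime_iff salg_carrier_add)
qed

lemma Jprime_sum: "(\<And>i. i \<in> I \<Longrightarrow> (F i :: 'k::idom salg) \<in> Jprime n) \<Longrightarrow> (\<Sum>i\<in>I. F i) \<in> Jprime n"
  by (induction I rule: infinite_finite_induct) (auto simp: Jprime_add Jprime_0)

lemma Jprime_mult_left:
  assumes "(a :: 'k::idom salg) \<in> Jprime n" "x \<in> salg_carrier n"
  shows "x \<star> a \<in> Jprime n"
proof -
  obtain m where a: "a \<in> salg_carrier n" "sconst (Delta n ^ (2 * m)) \<star> a \<in> Rspan n"
    using assms by (auto simp: Jprime_iff)
  have "sconst (Delta n ^ (2 * m)) \<star> (x \<star> a) \<in> Rspan n"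
    unfolding sconst_mult_left_commute[OF assms(2) a(1)] by (rule Rspan_mult_left[OF a(2) assms(2)])
  then show ?thesis using a(1) assms(2) by (auto simp: Jprime_iff salg_carrier_mult)
qed

lemma Rel_in_Jprime: "l \<in> {1..<n} \<Longrightarrow> (Rel n l :: 'k::idom salg) \<in> Jprime n"
  unfolding Jprime_iff by (intro conjI Rel_carrier exI[of _ 0]) (simp_all add: salg_mult_one Rel_in_Rspan)

lemma Jprime_saturated:
  assumes "sconst (Delta n ^ 2) \<star> a \<in> Jprime n" "(a :: 'k::idom salg) \<in> salg_carrier n"
  shows "a \<in> Jprime n"
proof -
  obtain m where "sconst (Delta n ^ (2 * m)) \<star> (sconst (Delta n ^ 2) \<star> a) \<in> Rspan n"
    using assms by (auto simp: Jprime_iff)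
  then have "sconst (Delta n ^ (2 * Suc m)) \<star> a \<in> Rspan n"
    by (simp add: sconst_mult_sconst power2_eq_square mult_ac)
  then show ?thesis unfolding Jprime_iff using assms(2) by blast
qed

section \<open>Weights\<close>

lemma wdeg_superset:
  assumes "finite A" "Poly_Mapping.keys w \<subseteq> A"
  shows "wdeg w = (\<Sum>l\<in>A. Poly_Mapping.lookup w l)"
  unfolding wdeg_def using assms by (intro sum.mono_neutral_left) (auto simp: in_keys_iff)

lemma wdeg_add: "wdeg (u + v) = wdeg u + wdeg v"
proof -
  let ?A = "Poly_Mapping.keys u \<union> Poly_Mapping.keys v"
  have "Poly_Mapping.keys (u + v) \<subseteq> ?A" by (rule keys_add)
  then show ?thesis
    by (simp add: wdeg_superset[of ?A] lookup_add sum.distrib)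
qed

lemma wdeg_single [simp]: "wdeg (Poly_Mapping.single l k) = k"
  by (simp add: wdeg_def)

lemma wdeg_0 [simp]: "wdeg 0 = 0"
  by (simp add: wdeg_def)

lemma remove_single:
  assumes "l \<in> Poly_Mapping.keys (w :: nat \<Rightarrow>\<^sub>0 nat)"
  obtains w' where "w = w' + Poly_Mapping.single l 1" "Poly_Mapping.keys w' \<subseteq> Poly_Mapping.keys w"
proof
  let ?w = "w - Poly_Mapping.single l 1"
  show "w = ?w + Poly_Mapping.single l 1"
    using assms by (intro poly_mapping_eqI)
      (auto simp: lookup_add lookup_minus lookup_single when_def in_keys_iff)
  show "Poly_Mapping.keys ?w \<subseteq> Poly_Mapping.keys w"
    by (auto simp: in_keys_iff lookup_minus)
qed

text \<open>No exponent of \<open>w\<close> exceeds \<open>wdeg w\<close>, which is at most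
  \<open>a\<close>, so there are only finitely many choices for \<open>w\<close> too.\<close>

lemma finite_Bset: "finite (Bset n a b)"
proof -
  let ?L = "(\<lambda>f. \<Sum>l\<in>{1..<n}. Poly_Mapping.single l (f l)) ` ({1..<n} \<rightarrow>\<^sub>E {..a})"
  have "Bset n a b \<subseteq> Pow {1..n} \<times> Pow {1..n} \<times> ?L"
  proof safe
    fix S T w assume "(S, T, w) \<in> Bset n a b"
    then have ST: "S \<subseteq> {1..n}" "T \<subseteq> {1..n}" and w: "Poly_Mapping.keys w \<subseteq> {1..<n}" "wdeg w \<le> a"
      by (auto simp: Bset_def mono_set_def)
    show "x \<in> {1..n}" if "x \<in> S" for x using that ST by auto
    show "x \<in> {1..n}" if "x \<in> T" for x using that ST by auto
    have "Poly_Mapping.lookup w l \<le> a" for l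
    proof (cases "l \<in> Poly_Mapping.keys w")
      case True
      then have "Poly_Mapping.lookup w l \<le> wdeg w"
        unfolding wdeg_def by (intro member_le_sum) auto
      then show ?thesis using w by simp
    qed (simp add: in_keys_iff)
    then have g: "restrict (Poly_Mapping.lookup w) {1..<n} \<in> {1..<n} \<rightarrow>\<^sub>E {..a}" by auto
    have w_eq: "(\<Sum>l\<in>{1..<n}. Poly_Mapping.single l (restrict (Poly_Mapping.lookup w) {1..<n} l)) = w"
    proof (rule poly_mapping_eqI)
      fix x
      show "Poly_Mapping.lookup (\<Sum>l\<in>{1..<n}. Poly_Mapping.single l (restrict (Poly_Mapping.lookup w) {1..<n} l)) x = Poly_Mapping.lookup w x"
        using w(1) by (cases "x \<in> {1..<n}") (auto simp: lookup_sum lookup_single when_def in_keys_iff subset_iff)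
    qed
    show "w \<in> ?L"
      using imageI[OF g, of "\<lambda>f. \<Sum>l\<in>{1..<n}. Poly_Mapping.single l (f l)"] unfolding w_eq .
  qed
  then show ?thesis by (rule finite_subset) (intro finite_SigmaI finite_imageI finite_PiE; simp)
qed

text \<open>Both kinds of monomial in a relation have weight (1, 1). The nonzero sign ensures that
  the new \<open>X_i\<close> and \<open>Y_j\<close> are not in \<open>M\<close> already, so that the
  cardinalities really grow by one.\<close>

lemma weight_mono_mult_Rel:
  assumes "M \<in> mono_set n" "N \<in> Poly_Mapping.keys (Rel n l :: 'k::comm_ring_1 salg)"
    "mono_sign M N \<noteq> (0 :: 'k tpoly)"
  shows "weight (mono_mult M N) = (Suc (fst (weight M)), Suc (snd (weight M)))"
proof -
  obtain S T w where M: "M = (S, T, w)" by (cases M)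
  have fin: "finite S" "finite T" using assms(1) finite_subset[of _ "{1..n}"] by (auto simp: M mono_set_def)
  show ?thesis
    using Rel_keys[OF assms(2)] assms(3) fin by (auto simp: M wdeg_add split: if_splits)
qed

lemma lookup_smono_Rel_nonzero:
  assumes "M \<in> mono_set n" "Poly_Mapping.lookup (smono M \<star> Rel n l :: 'k::comm_ring_1 salg) M' \<noteq> 0"
  shows "weight M' = (Suc (fst (weight M)), Suc (snd (weight M)))"
proof (rule ccontr)
  assume w: "\<not> ?thesis"
  have "(smono M \<star> Rel n l :: 'k salg) = (\<Sum>N\<in>Poly_Mapping.keys (Rel n l :: 'k salg).
      Poly_Mapping.single (mono_mult M N) (mono_sign M N * Poly_Mapping.lookup (Rel n l) N))"
    by (subst salg_mult_superset[of "{M}" "Poly_Mapping.keys (Rel n l :: 'k salg)"]) (auto simp: smono_def)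
  moreover have "Poly_Mapping.lookup (Poly_Mapping.single (mono_mult M N) (mono_sign M N * Poly_Mapping.lookup (Rel n l) N)) M' = (0 :: 'k tpoly)"
    if "N \<in> Poly_Mapping.keys (Rel n l :: 'k salg)" for N
    using weight_mono_mult_Rel[OF assms(1) that] w
    by (cases "mono_sign M N = (0 :: 'k tpoly)") (auto simp: lookup_single when_def)
  ultimately have "Poly_Mapping.lookup (smono M \<star> Rel n l :: 'k salg) M' = 0"
    by (simp add: lookup_sum)
  then show False using assms(2) by simp
qed

lemma lookup_mult_Rel:
  "Poly_Mapping.lookup (c \<star> Rel n l) M' =
    (\<Sum>M\<in>Poly_Mapping.keys c. Tmat n M' (M, l) * Poly_Mapping.lookup c M)"
proof -
  \<comment> \<open>Checked by expanding \<open>f\<close>, so that it holds for all monomials;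
    \<open>salg_mult_assoc\<close> speaks of those in \<open>mono_set n\<close>.\<close>
  have assoc: "Poly_Mapping.single M p \<star> f = sconst p \<star> (smono M \<star> f)" for M p and f :: "'a salg"
  proof -
    have "Poly_Mapping.single M p \<star> (\<Sum>N\<in>A. Poly_Mapping.single N (F N)) =
        sconst p \<star> (smono M \<star> (\<Sum>N\<in>A. Poly_Mapping.single N (F N)))" for A and F :: "mono \<Rightarrow> 'a tpoly"
      by (simp add: smono_def salg_mult_sum_right salg_mult_single sconst_mult_single mult_ac)
    from this[of "Poly_Mapping.lookup f" "Poly_Mapping.keys f"] show ?thesis
      unfolding salg_expand[of f, symmetric] .
  qed
  have "c \<star> Rel n l = (\<Sum>M\<in>Poly_Mapping.keys c. Poly_Mapping.single M (Poly_Mapping.lookup c M)) \<star> Rel n l"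
    by (simp only: salg_expand[symmetric])
  also have "\<dots> = (\<Sum>M\<in>Poly_Mapping.keys c. sconst (Poly_Mapping.lookup c M) \<star> (smono M \<star> Rel n l))"
    by (simp only: salg_mult_sum_left assoc)
  finally show ?thesis by (simp add: lookup_sum Tmat_def mult.commute)
qed

text \<open>Only monomials of \<open>c\<close> with weight exactly (1, 1) less than that of
  \<open>M'\<close> can contribute. As \<open>a\<close> and \<open>b\<close> are positive, the
  subtractions are genuine.\<close>

lemma lookup_mult_Rel_Bset:
  assumes "c \<in> salg_carrier n" "M' \<in> Bset n a b" "1 \<le> a" "1 \<le> b"
  shows "Poly_Mapping.lookup (c \<star> Rel n l) M' =
    (\<Sum>M\<in>Bset n (a - 1) (b - 1). Tmat n M' (M, l) * Poly_Mapping.lookup c M)"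
proof -
  have keys: "Poly_Mapping.keys c \<subseteq> mono_set n" using assms(1) by (simp add: salg_carrier_iff)
  have "(\<Sum>M\<in>Poly_Mapping.keys c. Tmat n M' (M, l) * Poly_Mapping.lookup c M) =
      (\<Sum>M\<in>Poly_Mapping.keys c \<inter> Bset n (a - 1) (b - 1). Tmat n M' (M, l) * Poly_Mapping.lookup c M)"
  proof (rule sum.mono_neutral_right)
    show "\<forall>M\<in>Poly_Mapping.keys c - Poly_Mapping.keys c \<inter> Bset n (a - 1) (b - 1).
        Tmat n M' (M, l) * Poly_Mapping.lookup c M = 0"
    proof
      fix M assume M: "M \<in> Poly_Mapping.keys c - Poly_Mapping.keys c \<inter> Bset n (a - 1) (b - 1)"
      then have M': "M \<in> mono_set n" "weight M \<noteq> (a - 1, b - 1)" using keys by (auto simp: Bset_def)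
      have "Tmat n M' (M, l) = (0 :: 'a tpoly)"
      proof (rule ccontr)
        assume "Tmat n M' (M, l) \<noteq> (0 :: 'a tpoly)"
        then have "weight M' = (Suc (fst (weight M)), Suc (snd (weight M)))"
          by (intro lookup_smono_Rel_nonzero[OF M'(1), where 'k = 'a]) (simp add: Tmat_def)
        then show False using M'(2) assms(2) by (cases "weight M") (auto simp: Bset_def)
      qed
      then show "Tmat n M' (M, l) * Poly_Mapping.lookup c M = 0" by simp
    qed
  qed auto
  also have "\<dots> = (\<Sum>M\<in>Bset n (a - 1) (b - 1). Tmat n M' (M, l) * Poly_Mapping.lookup c M)"
    by (rule sum.mono_neutral_left) (auto simp: finite_Bset in_keys_iff)
  finally show ?thesis by (simp only: lookup_mult_Rel)
qed

section \<open>Weight components of the saturation\<close>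

lemma lookup_Rspan_weight:
  assumes "(a :: 'k::idom salg) \<in> Rspan n" "Poly_Mapping.lookup a M \<noteq> 0"
  shows "1 \<le> fst (weight M)" "1 \<le> snd (weight M)"
proof -
  obtain c where a: "a = (\<Sum>l\<in>{1..<n}. c l \<star> Rel n l)" and c: "\<forall>l\<in>{1..<n}. c l \<in> salg_carrier n"
    using assms unfolding Rspan_def by blast
  obtain l where l: "l \<in> {1..<n}" "Poly_Mapping.lookup (c l \<star> Rel n l) M \<noteq> 0"
    using assms(2) unfolding a lookup_sum by (meson sum.not_neutral_contains_not_neutral)
  then obtain N where N: "N \<in> Poly_Mapping.keys (c l)" "Tmat n M (N, l) * Poly_Mapping.lookup (c l) N \<noteq> 0"
    unfolding lookup_mult_Rel by (meson sum.not_neutral_contains_not_neutral)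
  then have "N \<in> mono_set n" "Poly_Mapping.lookup (smono N \<star> Rel n l :: 'k salg) M \<noteq> 0"
    using c l by (auto simp: salg_carrier_iff Tmat_def)
  from lookup_smono_Rel_nonzero[OF this] show "1 \<le> fst (weight M)" "1 \<le> snd (weight M)" by auto
qed

lemma Jprime_weight_pos:
  assumes "(a :: 'k::idom salg) \<in> Jprime n" "M \<in> Poly_Mapping.keys a"
  shows "1 \<le> fst (weight M)" "1 \<le> snd (weight M)"
proof -
  obtain m where m: "sconst (Delta n ^ (2 * m)) \<star> a \<in> Rspan n"
    using assms(1) by (auto simp: Jprime_iff)
  have "Poly_Mapping.lookup (sconst (Delta n ^ (2 * m)) \<star> a) M \<noteq> 0"
    using assms(2) Delta_neq_0[of n, where 'k = 'k] by (simp add: in_keys_iff)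
  from lookup_Rspan_weight[OF m this] show "1 \<le> fst (weight M)" "1 \<le> snd (weight M)" .
qed

text \<open>A representation of a multiple of \<open>f\<close> by the relations is read off in
  weight \<open>(a, b)\<close>: the same power of \<open>Delta n\<close> works, and the vector
  \<open>y\<close> collects the coefficients of the \<open>c l\<close> in weight
  \<open>(a - 1, b - 1)\<close>.\<close>

lemma Jprime_component_Gset:
  assumes "(f :: 'k::idom salg) \<in> Jprime n" "1 \<le> a" "1 \<le> b"
  shows "restrict (Poly_Mapping.lookup f) (Bset n a b) \<in> Gset n a b"
proof -
  obtain m where f: "f \<in> salg_carrier n" and m: "sconst (Delta n ^ (2 * m)) \<star> f \<in> Rspan n"
    using assms(1) by (auto simp: Jprime_iff)
  then obtain c where eq: "sconst (Delta n ^ (2 * m)) \<star> f = (\<Sum>l\<in>{1..<n}. c l \<star> Rel n l)"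
    and c: "\<forall>l\<in>{1..<n}. c l \<in> salg_carrier n"
    unfolding Rspan_def by blast
  let ?Q = "Bset n (a - 1) (b - 1) \<times> {1..<n}"
  define y where "y = (\<lambda>q\<in>?Q. Poly_Mapping.lookup (c (snd q)) (fst q))"
  have "(\<lambda>M\<in>Bset n a b. Delta n ^ (2 * m) * restrict (Poly_Mapping.lookup f) (Bset n a b) M) =
      (\<lambda>M'\<in>Bset n a b. \<Sum>q\<in>?Q. Tmat n M' q * y q)"
  proof (rule restrict_ext)
    fix M' assume M': "M' \<in> Bset n a b"
    have "Delta n ^ (2 * m) * Poly_Mapping.lookup f M' = (\<Sum>l\<in>{1..<n}. Poly_Mapping.lookup (c l \<star> Rel n l) M')"
      using arg_cong[OF eq, of "\<lambda>g. Poly_Mapping.lookup g M'"] by (simp add: lookup_sum)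
    also have "\<dots> = (\<Sum>l\<in>{1..<n}. \<Sum>M\<in>Bset n (a - 1) (b - 1). Tmat n M' (M, l) * y (M, l))"
    proof (rule sum.cong[OF refl])
      fix l assume l: "l \<in> {1..<n}"
      show "Poly_Mapping.lookup (c l \<star> Rel n l) M' = (\<Sum>M\<in>Bset n (a - 1) (b - 1). Tmat n M' (M, l) * y (M, l))"
        unfolding lookup_mult_Rel_Bset[OF bspec[OF c l] M' assms(2,3)]
        by (rule sum.cong) (use l in \<open>simp_all add: y_def\<close>)
    qed
    also have "\<dots> = (\<Sum>q\<in>?Q. Tmat n M' q * y q)"
      by (subst sum.swap) (simp add: sum.cartesian_product case_prod_unfold)
    finally show "Delta n ^ (2 * m) * restrict (Poly_Mapping.lookup f) (Bset n a b) M' = (\<Sum>q\<in>?Q. Tmat n M' q * y q)"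
      using M' by simp
  qed
  moreover have "y \<in> ?Q \<rightarrow>\<^sub>E sym_polys n"
    using c by (auto simp: y_def salg_carrier_iff)
  ultimately have "(\<lambda>M\<in>Bset n a b. Delta n ^ (2 * m) * restrict (Poly_Mapping.lookup f) (Bset n a b) M) \<in> imT n a b"
    unfolding imT_def by (rule image_eqI)
  moreover have "restrict (Poly_Mapping.lookup f) (Bset n a b) \<in> Bset n a b \<rightarrow>\<^sub>E sym_polys n"
    using f by (auto simp: salg_carrier_iff)
  ultimately show ?thesis unfolding Gset_def by blast
qed

text \<open>Conversely, the entries of a preimage \<open>y\<close> under the matrix are assembled
  into homogeneous coefficients \<open>c l\<close> for the relations.\<close>

lemma Gset_sum_Jprime:
  assumes "(x :: mono \<Rightarrow> 'k::idom tpoly) \<in> Gset n a b" "1 \<le> a" "1 \<le> b"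
  shows "(\<Sum>M\<in>Bset n a b. Poly_Mapping.single M (x M)) \<in> Jprime n"
proof -
  let ?Q = "Bset n (a - 1) (b - 1) \<times> {1..<n}"
  let ?f = "\<Sum>M\<in>Bset n a b. Poly_Mapping.single M (x M)"
  obtain m y where x: "x \<in> Bset n a b \<rightarrow>\<^sub>E sym_polys n" and y: "y \<in> ?Q \<rightarrow>\<^sub>E sym_polys n"
    and eq: "(\<lambda>M\<in>Bset n a b. Delta n ^ (2 * m) * x M) = (\<lambda>M'\<in>Bset n a b. \<Sum>q\<in>?Q. Tmat n M' q * y q)"
    using assms(1) unfolding Gset_def imT_def by blast
  have B: "M \<in> mono_set n" if "M \<in> Bset n a b" for M a b using that by (simp add: Bset_def)
  have f: "?f \<in> salg_carrier n"
    using x B by (intro salg_carrier_sum salg_carrier_single) auto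
  define c where "c l = (\<Sum>M\<in>Bset n (a - 1) (b - 1). Poly_Mapping.single M (y (M, l)))" for l
  have c: "c l \<in> salg_carrier n" if "l \<in> {1..<n}" for l
    unfolding c_def using y B that by (intro salg_carrier_sum salg_carrier_single) auto
  have lookup_c: "Poly_Mapping.lookup (c l) M = (if M \<in> Bset n (a - 1) (b - 1) then y (M, l) else 0)" for l M
    by (simp add: c_def lookup_sum lookup_single when_def finite_Bset)
  have "sconst (Delta n ^ (2 * m)) \<star> ?f = (\<Sum>l\<in>{1..<n}. c l \<star> Rel n l)"
  proof (rule poly_mapping_eqI)
    fix M'
    have lf: "Poly_Mapping.lookup ?f M' = (if M' \<in> Bset n a b then x M' else 0)"
      by (simp add: lookup_sum lookup_single when_def finite_Bset)
    show "Poly_Mapping.lookup (sconst (Delta n ^ (2 * m)) \<star> ?f) M' =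
        Poly_Mapping.lookup (\<Sum>l\<in>{1..<n}. c l \<star> Rel n l) M'"
    proof (cases "M' \<in> Bset n a b")
      case True
      have "Poly_Mapping.lookup (\<Sum>l\<in>{1..<n}. c l \<star> Rel n l) M' =
          (\<Sum>l\<in>{1..<n}. \<Sum>M\<in>Bset n (a - 1) (b - 1). Tmat n M' (M, l) * y (M, l))"
        unfolding lookup_sum
        by (intro sum.cong refl, subst lookup_mult_Rel_Bset[OF c True assms(2,3)])
          (simp_all add: lookup_c)
      also have "\<dots> = (\<Sum>q\<in>?Q. Tmat n M' q * y q)"
        by (subst sum.swap) (simp add: sum.cartesian_product case_prod_unfold)
      also have "\<dots> = Delta n ^ (2 * m) * x M'"
        using fun_cong[OF eq, of M'] True by simp
      finally show ?thesis using True by (simp add: lf)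
    next
      \<comment> \<open>Outside weight \<open>(a, b)\<close> both sides vanish, since
        \<open>c l\<close> is homogeneous of weight \<open>(a - 1, b - 1)\<close>.\<close>
      case False
      have "Poly_Mapping.lookup (c l \<star> Rel n l) M' = 0" if l: "l \<in> {1..<n}" for l
      proof (rule ccontr)
        assume nz: "Poly_Mapping.lookup (c l \<star> Rel n l) M' \<noteq> 0"
        then obtain N where N: "N \<in> Poly_Mapping.keys (c l)" "Tmat n M' (N, l) * Poly_Mapping.lookup (c l) N \<noteq> 0"
          unfolding lookup_mult_Rel by (meson sum.not_neutral_contains_not_neutral)
        then have N': "N \<in> Bset n (a - 1) (b - 1)" "Poly_Mapping.lookup (smono N \<star> Rel n l :: 'k salg) M' \<noteq> 0"
          by (auto simp: lookup_c Tmat_def split: if_splits)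
        then have "weight M' = (a, b)"
          using lookup_smono_Rel_nonzero[OF B[OF N'(1)] N'(2)] assms(2,3) by (auto simp: Bset_def)
        moreover have "c l \<star> Rel n l \<in> salg_carrier n" by (intro salg_carrier_mult c l Rel_carrier)
        then have "M' \<in> mono_set n" using nz by (auto simp: salg_carrier_iff in_keys_iff)
        ultimately show False using False by (simp add: Bset_def)
      qed
      then have 0: "Poly_Mapping.lookup (\<Sum>l\<in>{1..<n}. c l \<star> Rel n l) M' = 0" by (simp add: lookup_sum)
      show ?thesis unfolding lookup_sconst_mult lf 0 using False by simp
    qed
  qed
  then have "sconst (Delta n ^ (2 * m)) \<star> ?f \<in> Rspan n"
    using RspanI[of n c] c by simp
  then show ?thesis using f unfolding Jprime_iff by blast
qed

text \<open>
  Modulo \<open>R\<^sub>l\<close>, a factor \<open>\<Delta>\<^sup>2W\<^sub>l\<close> may be replaced by \<open>X\<^sup>TA\<^sub>lY\<close>; once all \<open>W\<^sub>l\<close> are gone, a monomial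
  of weight \<open>(a, b)\<close> with \<open>a > n\<close> would need more than \<open>n\<close> distinct \<open>X\<^sub>i\<close>.
\<close>

lemma smono_in_Jprime:
  assumes "M \<in> mono_set n" "n < fst (weight M) \<or> n < snd (weight M)"
  shows "(smono M :: 'k::idom salg) \<in> Jprime n"
  using assms
proof (induction "wdeg (snd (snd M))" arbitrary: M)
  case 0
  obtain S T w where M: "M = (S, T, w)" by (cases M)
  have "card S \<le> n" "card T \<le> n"
    using 0(2) card_mono[of "{1..n}"] by (auto simp: M mono_set_def)
  then show ?case using 0(1,3) by (simp add: M)
next
  case (Suc d)
  obtain S T w where M: "M = (S, T, w)" by (cases M)
  have fin: "finite S" "finite T" using Suc.prems(1) finite_subset[of _ "{1..n}"] by (auto simp: M mono_set_def)
  have "w \<noteq> 0" using Suc.hyps(2) by (auto simp: M)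
  then have "Poly_Mapping.keys w \<noteq> {}" by simp
  then obtain l where l: "l \<in> Poly_Mapping.keys w" by blast
  obtain w' where w': "w = w' + Poly_Mapping.single l 1" "Poly_Mapping.keys w' \<subseteq> Poly_Mapping.keys w"
    using remove_single[OF l] .
  have wd: "wdeg w' = d" using Suc.hyps(2) by (simp add: M w'(1) wdeg_add)
  let ?N = "(S, T, w')"
  have l1: "l \<in> {1..<n}" and N: "?N \<in> mono_set n"
    using Suc.prems(1) l w'(2) by (auto simp: M mono_set_def)
  \<comment> \<open>A repeated generator makes the product 0. Otherwise one \<open>W\<close> has
    been traded for an \<open>X\<close> and a \<open>Y\<close>: the weight is unchanged and the
    degree in the \<open>W\<close> drops, so the induction hypothesis applies.\<close>
  have XY: "smono ?N \<star> Poly_Mapping.single ({i}, {j}, 0) (Amat n l $$ (i - 1, j - 1)) \<in> (Jprime n :: 'k salg set)"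
    if ij: "i \<in> {1..n}" "j \<in> {1..n}" for i j
  proof (cases "i \<in> S \<or> j \<in> T")
    case True
    then show ?thesis by (auto simp: smono_def salg_mult_single Jprime_0)
  next
    case False
    let ?M = "(insert i S, insert j T, w')"
    have M': "?M \<in> mono_set n" using N ij by (auto simp: mono_set_def)
    have "(smono ?M :: 'k salg) \<in> Jprime n"
      by (rule Suc.hyps(1)[OF _ M']) (use wd Suc.prems(2) False fin in \<open>auto simp: M w'(1) wdeg_add\<close>)
    moreover have "mono_sign ?N ({i}, {j}, 0) * Amat n l $$ (i - 1, j - 1) \<in> (sym_polys n :: 'k tpoly set)"
      by (intro sym_polys_mult mono_sign_sym Amat_sym) (use ij in auto)
    moreover have "mono_mult ?N ({i}, {j}, 0) = ?M" by simp
    then have "smono ?N \<star> Poly_Mapping.single ({i}, {j}, 0) (Amat n l $$ (i - 1, j - 1)) =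
        sconst (mono_sign ?N ({i}, {j}, 0) * Amat n l $$ (i - 1, j - 1)) \<star> (smono ?M :: 'k salg)"
      by (simp only: smono_def salg_mult_single sconst_mult_single mult_1_right)
    ultimately show ?thesis by (simp only: Jprime_mult_left sconst_carrier)
  qed
  have W: "smono ?N \<star> Poly_Mapping.single ({}, {}, Poly_Mapping.single l 1) (Delta n ^ 2) =
      (sconst (Delta n ^ 2) \<star> smono M :: 'k salg)"
    by (simp add: smono_def salg_mult_single sconst_mult_single M w'(1))
  have "smono ?N \<star> Rel n l + (\<Sum>i\<in>{1..n}. \<Sum>j\<in>{1..n}. smono ?N \<star> Poly_Mapping.single ({i}, {j}, 0) (Amat n l $$ (i - 1, j - 1))) =
      smono ?N \<star> (Rel n l + (\<Sum>i\<in>{1..n}. \<Sum>j\<in>{1..n}. Poly_Mapping.single ({i}, {j}, 0) (Amat n l $$ (i - 1, j - 1))) :: 'k salg)"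
    by (simp only: salg_mult_add_right salg_mult_sum_right)
  also have "\<dots> = sconst (Delta n ^ 2) \<star> smono M"
    unfolding Rel_eq diff_add_cancel by (rule W)
  finally have eq: "smono ?N \<star> Rel n l + (\<Sum>i\<in>{1..n}. \<Sum>j\<in>{1..n}. smono ?N \<star> Poly_Mapping.single ({i}, {j}, 0) (Amat n l $$ (i - 1, j - 1))) =
      (sconst (Delta n ^ 2) \<star> smono M :: 'k salg)" .
  have "(sconst (Delta n ^ 2) \<star> smono M :: 'k salg) \<in> Jprime n"
    unfolding eq[symmetric]
    by (intro Jprime_add Jprime_mult_left Rel_in_Jprime l1 smono_carrier N Jprime_sum XY)
  then show ?case by (rule Jprime_saturated) (rule smono_carrier[OF Suc.prems(1)])
qed

section \<open>The quotient algebra\<close>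

lemma Eideal_ideal: "ideal (Eideal n :: 'k::comm_ring_1 salg set) (Aprime n)"
  unfolding Eideal_def
  by (intro ring.genideal_ideal ring_Aprime) (auto simp: Aprime_simps intro!: sconst_carrier esym_sym)

lemma proj_hom: "proj n \<in> Ring.ring_hom (Aprime n) (Abar n :: 'k::comm_ring_1 salg set ring)"
  unfolding proj_def Abar_def using ideal.rcos_ring_hom[OF Eideal_ideal] .

lemma ring_Abar: "ring (Abar n :: 'k::comm_ring_1 salg set ring)"
  unfolding Abar_def by (rule ideal.quotient_is_ring[OF Eideal_ideal])

lemma proj_closed: "a \<in> salg_carrier n \<Longrightarrow> proj n a \<in> carrier (Abar n)"
  using Ring.ring_hom_closed[OF proj_hom] by (simp add: Aprime_simps)

lemma proj_add: "a \<in> salg_carrier n \<Longrightarrow> b \<in> salg_carrier n \<Longrightarrow> proj n (a + b) = proj n a \<oplus>\<^bsub>Abar n\<^esub> proj n b"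
  using Ring.ring_hom_add[OF proj_hom, of a n b] by (simp add: Aprime_simps)

lemma proj_mult: "a \<in> salg_carrier n \<Longrightarrow> b \<in> salg_carrier n \<Longrightarrow> proj n (a \<star> b) = proj n a \<otimes>\<^bsub>Abar n\<^esub> proj n b"
  using Ring.ring_hom_mult[OF proj_hom, of a n b] by (simp add: Aprime_simps)

lemma proj_0: "proj n 0 = \<zero>\<^bsub>Abar n\<^esub>"
  using Ring.ring_hom_zero[OF proj_hom ring_Aprime ring_Abar] by (simp add: Aprime_simps)

lemma proj_Eideal:
  assumes "(a :: 'k::comm_ring_1 salg) \<in> Eideal n"
  shows "proj n a = \<zero>\<^bsub>Abar n\<^esub>"
proof -
  interpret ideal "Eideal n :: 'k salg set" "Aprime n" by (rule Eideal_ideal)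
  show ?thesis
    unfolding proj_def Abar_def using a_rcos_const[OF assms] by (simp add: FactRing_def)
qed

lemma proj_cong:
  assumes "(a :: 'k::comm_ring_1 salg) \<in> salg_carrier n" "b \<in> salg_carrier n" "a - b \<in> Eideal n"
  shows "proj n a = proj n b"
proof -
  interpret ring "Abar n :: 'k salg set ring" by (rule ring_Abar)
  have "proj n a = proj n ((a - b) + b)" by simp
  also have "\<dots> = proj n (a - b) \<oplus>\<^bsub>Abar n\<^esub> proj n b"
    using ideal.Icarr[OF Eideal_ideal assms(3)] assms(2) by (intro proj_add) (simp_all add: Aprime_simps)
  finally show ?thesis using proj_Eideal[OF assms(3)] proj_closed[OF assms(2)] by simp
qed

lemma finsum_proj:
  assumes "finite I" "\<And>i. i \<in> I \<Longrightarrow> (F i :: 'k::comm_ring_1 salg) \<in> salg_carrier n"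
  shows "finsum (Abar n) (\<lambda>i. proj n (F i)) I = proj n (\<Sum>i\<in>I. F i)"
proof -
  interpret ring "Abar n :: 'k salg set ring" by (rule ring_Abar)
  show ?thesis
    using assms
  proof (induction I rule: finite_induct)
    case (insert i I)
    then show ?case
      by (subst finsum_insert) (auto simp: proj_add salg_carrier_sum intro!: proj_closed)
  qed (simp add: proj_0)
qed

lemma tconst_sym: "tconst c \<in> sym_polys n"
  unfolding tconst_def by (rule sym_polys_const)

lemma kscale_proj: "a \<in> salg_carrier n \<Longrightarrow> kscale n c (proj n a) = proj n (sconst (tconst c) \<star> a)"
  unfolding kscale_def by (rule proj_mult[symmetric]) (intro sconst_carrier tconst_sym)

text \<open>The symmetric polynomials whose image under \<open>sconst\<close> lies in
  \<open>Eideal n\<close> form an ideal containing the generators, hence all of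
  \<open>Epoly n\<close>.\<close>

lemma Epoly_Eideal:
  assumes "(p :: 'k::comm_ring_1 tpoly) \<in> Epoly n"
  shows "sconst p \<in> Eideal n"
proof -
  interpret E: ideal "Eideal n :: 'k salg set" "Aprime n" by (rule Eideal_ideal)
  have add: "sconst (p + q) = sconst p + sconst q" and mult: "sconst (p * q) = sconst p \<star> sconst q" for p q :: "'k tpoly"
    by (simp_all add: sconst_def single_add salg_mult_single)
  let ?I = "{p \<in> sym_polys n. sconst p \<in> (Eideal n :: 'k salg set)}"
  have mult_closed: "sconst (q * p) \<in> Eideal n" if "p \<in> ?I" "q \<in> sym_polys n" for p q
    unfolding mult using that E.I_l_closed[of "sconst p" "sconst q"] by (simp add: Aprime_simps sconst_carrier)
  have "ideal ?I (Lam n)"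
  proof (rule Lam_idealI)
    have "sconst 0 \<in> (Eideal n :: 'k salg set)"
      using additive_subgroup.zero_closed[OF E.additive_subgroup_axioms] by (simp add: Aprime_simps sconst_def)
    then show "0 \<in> ?I" by simp
  next
    fix p q :: "'k tpoly" assume "p \<in> ?I" "q \<in> ?I"
    then show "p + q \<in> ?I"
      using additive_subgroup.a_closed[OF E.additive_subgroup_axioms, of "sconst p" "sconst q"]
      by (simp add: sym_polys_add add Aprime_simps)
  next
    fix p q :: "'k tpoly" assume "p \<in> ?I" "q \<in> sym_polys n"
    then show "q * p \<in> ?I" using mult_closed by (simp add: sym_polys_mult)
  qed auto
  moreover have "esym n ` {1..n} \<subseteq> ?I"
  proof -
    have "(\<lambda>l. sconst (esym n l)) ` {1..n} \<subseteq> (Eideal n :: 'k salg set)"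
      unfolding Eideal_def
      by (rule ring.genideal_self[OF ring_Aprime]) (auto simp: Aprime_simps intro!: sconst_carrier esym_sym)
    then show ?thesis using esym_sym by blast
  qed
  ultimately have "Epoly n \<subseteq> ?I"
    unfolding Epoly_def by (rule ring.genideal_minimal[OF cring.axioms(1)[OF cring_Lam]])
  then show ?thesis using assms by blast
qed

text \<open>Passes from coefficients in \<open>Lam n\<close> to scalars: \<open>p\<close> and its
  residue differ by an element of \<open>Epoly n\<close>, whose multiples of \<open>smono M\<close>
  vanish in the quotient.\<close>

lemma proj_single:
  fixes p :: "'k::field tpoly"
  assumes "of_nat (fact n) \<noteq> (0::'k)" "M \<in> mono_set n" "p \<in> sym_polys n"
  shows "proj n (Poly_Mapping.single M p) = kscale n (red n p) (Mbar n M)"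
proof -
  let ?c = "tconst (red n p)"
  have "sconst (p - ?c) \<in> Eideal n" by (intro Epoly_Eideal red_residue assms)
  then have "sconst (p - ?c) \<star> smono M \<in> Eideal n"
    using ideal.I_r_closed[OF Eideal_ideal, of "sconst (p - ?c)" n "smono M"] smono_carrier[OF assms(2)]
    by (simp add: Aprime_simps)
  also have "sconst (p - ?c) \<star> smono M = Poly_Mapping.single M p - sconst ?c \<star> smono M"
    by (simp add: smono_def sconst_mult_single single_diff)
  finally have "proj n (Poly_Mapping.single M p) = proj n (sconst ?c \<star> smono M)"
    by (intro proj_cong salg_carrier_single salg_carrier_mult sconst_carrier tconst_sym smono_carrier assms)
  then show ?thesis unfolding Mbar_def by (simp add: kscale_proj smono_carrier[OF assms(2)])
qed

section \<open>Linear spans in the quotient\<close>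

lemma kscale_1:
  assumes "v \<in> proj n ` salg_carrier n"
  shows "kscale n 1 v = v"
proof -
  have "sconst (tconst 1) = sconst (1 :: 'a tpoly)" by (simp add: tconst_def)
  then show ?thesis using assms by (auto simp: kscale_proj salg_mult_one)
qed

text \<open>Linear combinations are computed on representatives in \<open>A'\<close>, where addition is a type-class operation.\<close>

lemma kspan_eq:
  fixes S :: "'k::comm_ring_1 salg set set"
  assumes "\<And>v. v \<in> S \<Longrightarrow> r v \<in> salg_carrier n \<and> proj n (r v) = v"
  shows "kspan n S = {proj n (\<Sum>v\<in>F. sconst (tconst (c v)) \<star> r v) | c F. finite F \<and> F \<subseteq> S}"
proof -
  interpret ring "Abar n :: 'k salg set ring" by (rule ring_Abar)
  have "finsum (Abar n) (\<lambda>v. kscale n (c v) v) F = proj n (\<Sum>v\<in>F. sconst (tconst (c v)) \<star> r v)"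
    if F: "finite F" "F \<subseteq> S" for c F
  proof -
    have carr: "sconst (tconst (c v)) \<star> r v \<in> salg_carrier n" if "v \<in> F" for v
      using that F assms[of v] by (intro salg_carrier_mult sconst_carrier tconst_sym) auto
    have "finsum (Abar n) (\<lambda>v. kscale n (c v) v) F = finsum (Abar n) (\<lambda>v. proj n (sconst (tconst (c v)) \<star> r v)) F"
    proof (rule finsum_cong'[OF refl])
      fix v assume v: "v \<in> F"
      then have "r v \<in> salg_carrier n" "proj n (r v) = v" using assms[of v] F by auto
      then show "kscale n (c v) v = proj n (sconst (tconst (c v)) \<star> r v)"
        using kscale_proj[of "r v" n "c v"] by simp
    qed (auto intro!: proj_closed carr)
    also have "\<dots> = proj n (\<Sum>v\<in>F. sconst (tconst (c v)) \<star> r v)"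
      by (rule finsum_proj) (use F carr in auto)
    finally show ?thesis .
  qed
  then show ?thesis unfolding kspan_def by (intro Collect_cong ex_cong1 iffI; elim conjE; simp)
qed

lemma kspan_add:
  fixes S :: "'k::comm_ring_1 salg set set"
  assumes "S \<subseteq> proj n ` salg_carrier n" "u \<in> kspan n S" "v \<in> kspan n S"
  shows "u \<oplus>\<^bsub>Abar n\<^esub> v \<in> kspan n S"
proof -
  have "\<forall>v\<in>S. \<exists>r. r \<in> salg_carrier n \<and> proj n r = v" using assms(1) by blast
  then obtain r where r: "\<And>v. v \<in> S \<Longrightarrow> r v \<in> salg_carrier n \<and> proj n (r v) = v" by metis
  let ?s = "\<lambda>c F. \<Sum>v\<in>F. sconst (tconst (c v)) \<star> r v"
  have eq: "kspan n S = {proj n (?s c F) | c F. finite F \<and> F \<subseteq> S}"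
    by (rule kspan_eq) (rule r)
  obtain c F where u: "u = proj n (?s c F)" and F: "finite F" "F \<subseteq> S"
    using assms(2) unfolding eq by blast
  obtain d G where v: "v = proj n (?s d G)" and G: "finite G" "G \<subseteq> S"
    using assms(3) unfolding eq by blast
  have carr: "?s c F \<in> salg_carrier n" if "F \<subseteq> S" for c F
    using that r by (intro salg_carrier_sum salg_carrier_mult sconst_carrier tconst_sym) auto
  \<comment> \<open>Both coefficient functions are extended by 0 to the union, so that coefficients
    of common vectors add.\<close>
  let ?e = "\<lambda>v. (if v \<in> F then c v else 0) + (if v \<in> G then d v else 0)"
  have ext: "?s c F = ?s (\<lambda>v. if v \<in> F then c v else 0) (F \<union> G)" if "finite F" "finite G" for c F G
    using that by (intro sum.mono_neutral_cong_left) (auto simp: tconst_def sconst_def)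
  have "?s c F + ?s d G = ?s (\<lambda>v. if v \<in> F then c v else 0) (F \<union> G) + ?s (\<lambda>v. if v \<in> G then d v else 0) (F \<union> G)"
    using ext[OF F(1) G(1), of c] ext[OF G(1) F(1), of d] by (simp only: Un_commute)
  also have "\<dots> = ?s ?e (F \<union> G)"
    by (simp only: sum.distrib[symmetric] tconst_def sconst_def single_add salg_mult_add_left)
  finally have "u \<oplus>\<^bsub>Abar n\<^esub> v = proj n (?s ?e (F \<union> G))"
    unfolding u v using proj_add[OF carr[OF F(2), of c] carr[OF G(2), of d]] by (simp only:)
  moreover have "finite (F \<union> G)" "F \<union> G \<subseteq> S" using F G by auto
  ultimately show ?thesis
    unfolding eq mem_Collect_eq by (intro exI[of _ ?e] exI[of _ "F \<union> G"] conjI)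
qed

lemma kspan_scale:
  fixes S :: "'k::comm_ring_1 salg set set"
  assumes "S \<subseteq> proj n ` salg_carrier n" "v \<in> S"
  shows "kscale n c v \<in> kspan n S"
proof -
  interpret ring "Abar n :: 'k salg set ring" by (rule ring_Abar)
  have "kscale n c v \<in> carrier (Abar n)"
    using assms by (auto simp: kscale_proj subset_iff
        intro!: proj_closed salg_carrier_mult sconst_carrier tconst_sym dest!: bspec)
  then have "finsum (Abar n) (\<lambda>v. kscale n c v) {v} = kscale n c v"
    by (subst finsum_insert) auto
  then show ?thesis unfolding kspan_def using assms(2)
    by (intro CollectI exI[of _ "\<lambda>_. c"] exI[of _ "{v}"]) simp
qed

lemma kspan_proj_sum:
  fixes F :: "'i \<Rightarrow> 'k::comm_ring_1 salg"
  assumes "S \<subseteq> proj n ` salg_carrier n" "finite I"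
    "\<And>i. i \<in> I \<Longrightarrow> F i \<in> salg_carrier n" "\<And>i. i \<in> I \<Longrightarrow> proj n (F i) \<in> kspan n S"
  shows "proj n (\<Sum>i\<in>I. F i) \<in> kspan n S"
  using assms(2-)
proof (induction I rule: finite_induct)
  case empty
  interpret ring "Abar n :: 'k salg set ring" by (rule ring_Abar)
  have "finsum (Abar n) (\<lambda>v. kscale n 0 v) {} \<in> kspan n S"
    unfolding kspan_def by (intro CollectI exI[of _ "\<lambda>_. 0"] exI[of _ "{}"]) simp
  then show ?case by (simp add: proj_0)
next
  case (insert i I)
  then have "proj n (F i) \<oplus>\<^bsub>Abar n\<^esub> proj n (\<Sum>i\<in>I. F i) \<in> kspan n S"
    by (intro kspan_add assms(1)) auto
  then show ?case using insert by (simp add: proj_add salg_carrier_sum)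
qed

text \<open>With representatives chosen in \<open>Jprime n\<close>, which is closed under sums and
  left multiplication, a linear combination has a representative there too.\<close>

lemma kspan_subset_Jbar:
  fixes S :: "'k::idom salg set set"
  assumes "S \<subseteq> Jbar n"
  shows "kspan n S \<subseteq> Jbar n"
proof
  fix u assume u: "u \<in> kspan n S"
  have "\<forall>v\<in>S. \<exists>r. r \<in> Jprime n \<and> proj n r = v" using assms unfolding Jbar_def by blast
  then obtain r where r: "\<And>v. v \<in> S \<Longrightarrow> r v \<in> Jprime n \<and> proj n (r v) = v" by metis
  then have "\<And>v. v \<in> S \<Longrightarrow> r v \<in> salg_carrier n \<and> proj n (r v) = v" by (simp add: Jprime_iff)
  then obtain c F where "u = proj n (\<Sum>v\<in>F. sconst (tconst (c v)) \<star> r v)" "F \<subseteq> S"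
    using u kspan_eq[of S r n] by auto
  moreover have "(\<Sum>v\<in>F. sconst (tconst (c v)) \<star> r v) \<in> Jprime n"
    using \<open>F \<subseteq> S\<close> r by (intro Jprime_sum Jprime_mult_left sconst_carrier tconst_sym) auto
  ultimately show "u \<in> Jbar n" unfolding Jbar_def by blast
qed

text \<open>Recognises a combination of the \<open>Mbar n M\<close> with reduced coefficients as the
  image of one element of \<open>A'\<close>, the one with coefficient vector
  \<open>x\<close>.\<close>

lemma finsum_Mbar:
  fixes x :: "mono \<Rightarrow> 'k::field tpoly"
  assumes "of_nat (fact n) \<noteq> (0::'k)" "\<And>M. M \<in> Bset n a b \<Longrightarrow> x M \<in> sym_polys n"
  shows "finsum (Abar n) (\<lambda>M. kscale n ((\<lambda>M\<in>Bset n a b. red n (x M)) M) (Mbar n M)) (Bset n a b) =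
    proj n (\<Sum>M\<in>Bset n a b. Poly_Mapping.single M (x M))"
proof -
  interpret ring "Abar n :: 'k salg set ring" by (rule ring_Abar)
  have M: "M \<in> mono_set n" if "M \<in> Bset n a b" for M using that by (simp add: Bset_def)
  have "finsum (Abar n) (\<lambda>M. kscale n ((\<lambda>M\<in>Bset n a b. red n (x M)) M) (Mbar n M)) (Bset n a b) =
      finsum (Abar n) (\<lambda>M. proj n (Poly_Mapping.single M (x M))) (Bset n a b)"
    by (rule finsum_cong'[OF refl])
      (auto simp: proj_single[OF assms(1) M assms(2)] intro!: proj_closed salg_carrier_single M assms(2))
  also have "\<dots> = proj n (\<Sum>M\<in>Bset n a b. Poly_Mapping.single M (x M))"
    by (rule finsum_proj[OF finite_Bset]) (intro salg_carrier_single M assms(2))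
  finally show ?thesis .
qed

theorem corollary6p5:
  fixes n :: nat
  assumes "n \<ge> 1"
    and "CHAR('k::field) = 0 \<or> coprime CHAR('k) (fact n)"
  shows "(Jbar n :: 'k salg set set) = kspan n
    ({Mbar n M | M a b. M \<in> Bset n a b \<and> (a > n \<or> b > n)} \<union>
     {finsum (Abar n) (\<lambda>M. kscale n (f M) (Mbar n M)) (Bset n a b) | f a b.
        1 \<le> a \<and> a \<le> n \<and> 1 \<le> b \<and> b \<le> n \<and> f \<in> Gbar n a b})"
    (is "_ = kspan n (?S1 \<union> ?S2)")
proof
  have char: "of_nat (fact n) \<noteq> (0::'k)" by (rule of_nat_fact_neq_0[OF assms(2)])
  have S1: "?S1 \<subseteq> Jbar n"
    unfolding Jbar_def Mbar_def using smono_in_Jprime[of _ n, where 'k = 'k] by (fastforce simp: Bset_def)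
  have S2: "?S2 \<subseteq> Jbar n"
  proof safe
    fix f a b assume ab: "1 \<le> a" "1 \<le> b" and "f \<in> (Gbar n a b :: (mono \<Rightarrow> 'k) set)"
    then obtain x where x: "x \<in> Gset n a b" and f: "f = (\<lambda>M\<in>Bset n a b. red n (x M))"
      unfolding Gbar_def by blast
    have xs: "x M \<in> sym_polys n" if "M \<in> Bset n a b" for M
      using x that unfolding Gset_def by auto
    show "finsum (Abar n) (\<lambda>M. kscale n (f M) (Mbar n M)) (Bset n a b) \<in> Jbar n"
      using finsum_Mbar[OF char, of a b x] xs Gset_sum_Jprime[OF x ab] unfolding f Jbar_def by simp
  qed
  show "kspan n (?S1 \<union> ?S2) \<subseteq> (Jbar n :: 'k salg set set)"
    by (rule kspan_subset_Jbar[OF Un_least[OF S1 S2]])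
  have S: "?S1 \<union> ?S2 \<subseteq> proj n ` salg_carrier n"
  proof (rule order_trans[OF Un_least[OF S1 S2]])
    show "Jbar n \<subseteq> proj n ` (salg_carrier n :: 'k salg set)"
      unfolding Jbar_def by (rule image_mono) (auto simp: Jprime_iff)
  qed
  show "(Jbar n :: 'k salg set set) \<subseteq> kspan n (?S1 \<union> ?S2)"
  proof
    fix v :: "'k salg set" assume "v \<in> Jbar n"
    then obtain g where g: "g \<in> Jprime n" and v: "v = proj n g" unfolding Jbar_def by blast
    then have gc: "g \<in> salg_carrier n" by (simp add: Jprime_iff)
    let ?K = "Poly_Mapping.keys g"
    let ?s = "\<lambda>M. Poly_Mapping.single M (Poly_Mapping.lookup g M)"
    let ?comp = "\<lambda>W. \<Sum>M | M \<in> ?K \<and> weight M = W. ?s M"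
    have gs: "Poly_Mapping.lookup g M \<in> sym_polys n" for M
      using gc unfolding salg_carrier_iff by blast
    have s: "?s M \<in> salg_carrier n" if "M \<in> mono_set n" for M
      using that gs by (rule salg_carrier_single)
    have K: "M \<in> mono_set n" if "M \<in> ?K" for M using that gc by (auto simp: salg_carrier_iff)
    have "g = (\<Sum>M\<in>?K. ?s M)" by (rule salg_expand)
    also have "\<dots> = (\<Sum>W\<in>weight ` ?K. ?comp W)"
      using sum.image_gen[of ?K ?s weight] by simp
    finally have g_eq: "g = (\<Sum>W\<in>weight ` ?K. ?comp W)" .
    have comp: "proj n (?comp W) \<in> kspan n (?S1 \<union> ?S2)" if W: "W \<in> weight ` ?K" for W
    proof -
      obtain a b where ab: "W = (a, b)" by (cases W)
      have pos: "1 \<le> a" "1 \<le> b" using W Jprime_weight_pos[OF g] by (force simp: ab)+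
      show ?thesis
      proof (cases "a > n \<or> b > n")
        \<comment> \<open>Each monomial of this weight is itself a generator of type (i), so the
          component is treated term by term.\<close>
        case True
        have "proj n (?s M) \<in> kspan n (?S1 \<union> ?S2)" if M: "M \<in> ?K" "weight M = W" for M
        proof -
          have "M \<in> Bset n a b" using M K[OF M(1)] by (simp add: ab Bset_def)
          then have "Mbar n M \<in> ?S1" using True by blast
          then have "kscale n (red n (Poly_Mapping.lookup g M)) (Mbar n M) \<in> kspan n (?S1 \<union> ?S2)"
            by (intro kspan_scale[OF S]) blast
          then show ?thesis
            using proj_single[OF char K[OF M(1)] gs] by simp
        qed
        then show ?thesis using s K by (intro kspan_proj_sum[OF S]) auto
      next
        \<comment> \<open>Single terms need not lie in the span here. The component is kept whole:
          its coefficient vector lies in \<open>Gset n a b\<close>, which makes its image a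
          generator of type (ii).\<close>
        case False
        let ?f = "\<lambda>M\<in>Bset n a b. red n (Poly_Mapping.lookup g M)"
        have "?comp W = (\<Sum>M\<in>Bset n a b. ?s M)"
          using K by (intro sum.mono_neutral_left finite_Bset) (auto simp: Bset_def ab in_keys_iff)
        then have eq: "proj n (?comp W) = finsum (Abar n) (\<lambda>M. kscale n (?f M) (Mbar n M)) (Bset n a b)"
          using finsum_Mbar[OF char, of a b "Poly_Mapping.lookup g"] gs by simp
        have "(\<lambda>M\<in>Bset n a b. red n (restrict (Poly_Mapping.lookup g) (Bset n a b) M)) \<in> Gbar n a b"
          unfolding Gbar_def by (intro imageI Jprime_component_Gset g pos)
        also have "(\<lambda>M\<in>Bset n a b. red n (restrict (Poly_Mapping.lookup g) (Bset n a b) M)) = ?f"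
          by (rule restrict_ext) simp
        finally have fG: "?f \<in> Gbar n a b" .
        have "proj n (?comp W) \<in> ?S2"
          unfolding eq mem_Collect_eq
          by (rule exI[of _ ?f], rule exI[of _ a], rule exI[of _ b]) (use False pos fG in \<open>simp only: not_less de_Morgan_disj simp_thms\<close>)
        \<comment> \<open>Elements of \<open>kspan\<close> are built from scaled generators, so the
          generator enters as 1 times itself.\<close>
        moreover from this have "kscale n 1 (proj n (?comp W)) = proj n (?comp W)"
          using S by (intro kscale_1) blast
        ultimately show ?thesis using kspan_scale[OF S, of "proj n (?comp W)" 1] by auto
      qed
    qed
    have comp_carrier: "?comp W \<in> salg_carrier n" for W
      by (intro salg_carrier_sum s K) simp
    have "proj n (\<Sum>W\<in>weight ` ?K. ?comp W) \<in> kspan n (?S1 \<union> ?S2)"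
      by (rule kspan_proj_sum[OF S finite_imageI[OF finite_keys] comp_carrier]) (rule comp)
    then show "v \<in> kspan n (?S1 \<union> ?S2)"
      unfolding v g_eq[symmetric] .
  qed
qed

end
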